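(* For every orbital semilattice $V$ there exist a nonempty set $G$ and an embedding (injective homomorphism of orbital semilattices) of $V$ into the table algebra $(\mathrm{Tab}(G),\Join,\emptyset,\{\langle\rangle\},\cdot,(E_{xy})_{x,y\in\mathbf{var}},\mathrm{schema})$.
   Context: **Partial transformations.** $\mathbf{var}=\{x_1,x_2,x_3,\dots\}$ is a fixed countably infinite set of variables (enumerated without repetition); $\mathfrak{P}(\mathbf{var})$ is its power set and $\mathfrak{P}_{\mathrm{fin}}(\mathbf{var})$ the set of its finite subsets. For a partial function $f$, $\mathrm{def}(f)$ is its domain of definition, $\mathrm{rng}(f)$ its range, and $f^{-1}(Z)=\{a\in\mathrm{def}(f)\mid f(a)\in Z\}$. $\mathcal{T}_{\mathrm{fp}}(\mathbf{var})$ is the set of partial functions $f:\mathbf{var}\rightharpoonup\mathbf{var}$ with $\mathrm{def}(f)$ finite. Composition $\mu\circ\lambda$ is relational: $\mathrm{def}(\mu\circ\lambda)=\lambda^{-1}(\mathrm{def}(\mu))$ and $(\mu\circ\lambda)(x)=\mu(\lambda(x))$. $\pi_X$ is the identity on $X\subseteq\mathbf{var}$, regarded as a partial function. $\tfrac{z_1\dots z_n}{y_1\dots y_n}$ is the function with domain $\{y_1,\dots,y_n\}$ and $y_i\mapsto z_i$ (so $\tfrac{xx}{xy}$ is the function $\{x,y\}\to\{x\}$, also when $x=y$). **Orbital semilattice.** A structure $(V,\wedge,0,1,\cdot,(d_{xy})_{x,y\in\mathbf{var}},\mathrm{dom})$ where $(V,\wedge,0,1)$ is a bounded meet-semilattice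 with bottom $0$ and top $1$ (order: $u\le v\Leftrightarrow u\wedge v=u$), $\cdot:V\times\mathcal{T}_{\mathrm{fp}}(\mathbf{var})\to V$, $d_{xy}\in V$, $\mathrm{dom}:V\to\mathfrak{P}(\mathbf{var})$, such that for all $u,v\in V$, $\lambda,\mu\in\mathcal{T}_{\mathrm{fp}}(\mathbf{var})$, $x,y\in\mathbf{var}$, $Y\in\mathfrak{P}_{\mathrm{fin}}(\mathbf{var})$ (with $\cdot$ binding stronger than $\wedge$): (A1) $u\ne0\Rightarrow u\cdot\pi_\emptyset=1$; (A2) $0\cdot\lambda=0$; (A3) $\mathrm{dom}(u)\subseteq Y\Rightarrow(u\wedge v)\cdot\pi_Y=u\wedge v\cdot\pi_Y$; (A4) $u\le u\cdot\pi_Y$; (A5) $u\le v\Rightarrow u\cdot\lambda\le v\cdot\lambda$; (A6) $(0\ne u\le d_{xy}$ and $x\ne y)\Rightarrow u=(u\cdot\pi_{\mathrm{dom}(u)\setminus\{y\}})\wedge d_{xy}$; (A7) $(u\cdot\lambda)\cdot\mu=u\cdot(\lambda\circ\mu)$; (A8) $u\cdot\pi_{\mathrm{dom}(u)}=u$; (A9) $d_{xx}\ne0$; (A10) $d_{xy}=d_{xx}\cdot\tfrac{xx}{xy}$; (A11) $u\ne0\Rightarrow\mathrm{dom}(u\cdot\lambda)=\lambda^{-1}(\mathrm{dom}(u))$; (A12) $u\ne0\Rightarrow\mathrm{dom}(u)$ is finite; (A13) $\mathrm{dom}(u)=\{x\in\mathbf{var}\mid u\le d_{xx}\}$. By convention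 $w\cdot\pi_{\mathbf{var}}:=w$ for $w\in V$ (relevant to (A8) for $u=0$, as $\mathrm{dom}(0)=\mathbf{var}$). **Table algebra.** For a nonempty set $G$, $\mathrm{Tab}(G):=\bigcup_{X\in\mathfrak{P}_{\mathrm{fin}}(\mathbf{var})}\mathfrak{P}(G^X)$, i.e. a table is a set $T\subseteq G^X$ for some finite $X\subseteq\mathbf{var}$. $\mathrm{schema}(T):=X$ if $\emptyset\neq T\subseteq G^X$, and $\mathrm{schema}(\emptyset):=\mathbf{var}$. $T_1\Join T_2:=\{t\in G^{\mathrm{schema}(T_1)\cup\mathrm{schema}(T_2)}\mid t|_{\mathrm{schema}(T_1)}\in T_1,\ t|_{\mathrm{schema}(T_2)}\in T_2\}$. $\langle\rangle$ is the empty tuple. $T\cdot\lambda:=\{t\circ\lambda\mid t\in T\}$. $E_{xy}:=\{t\in G^{\{x,y\}}\mid t(x)=t(y)\}$. This structure is an orbital semilattice with bottom $\emptyset$ and top $\{\langle\rangle\}$. **Homomorphism.** A homomorphism of orbital semilattices $\varphi:V\to W$ is a map preserving $\wedge$, $0$, $1$, all diagonals, right multiplication ($\varphi(u\cdot\lambda)=\varphi(u)\cdot\lambda$) and domains ($\mathrm{dom}(\varphi(u))=\mathrm{dom}(u)$). *)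

theory Defs
  imports Main "HOL-Library.FuncSet"
begin

text \<open>
  Variables are natural numbers. Partial functions are maps, relational composition is
  \<^const>\<open>map_comp\<close>, and the restriction of a tuple to a set of variables is
  \<^const>\<open>restrict_map\<close>.
\<close>

type_synonym var = nat

definition T_fp :: "(var \<rightharpoonup> var) set" where
  "T_fp = {\<nu>. finite (dom \<nu>)}"

definition pmap_vimage :: "('b \<rightharpoonup> 'c) \<Rightarrow> 'c set \<Rightarrow> 'b set" where
  "pmap_vimage f Z = {a. \<exists>b\<in>Z. f a = Some b}"

definition pid :: "var set \<Rightarrow> (var \<rightharpoonup> var)" where
  "pid X = (\<lambda>x. if x \<in> X then Some x else None)"


section \<open>Orbital semilattices\<close>

record 'a orbital_alg =
  carrier :: "'a set"
  meet :: "'a \<Rightarrow> 'a \<Rightarrow> 'a" (infixl "\<sqinter>\<index>" 70)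
  zero :: 'a ("\<zero>\<index>")
  one :: 'a ("\<one>\<index>")
  act :: "'a \<Rightarrow> (var \<rightharpoonup> var) \<Rightarrow> 'a" (infixl "\<cdot>\<index>" 75)
  diag :: "var \<Rightarrow> var \<Rightarrow> 'a"
  odom :: "'a \<Rightarrow> var set"

definition ole :: "('a, 'm) orbital_alg_scheme \<Rightarrow> 'a \<Rightarrow> 'a \<Rightarrow> bool" (infix "\<sqsubseteq>\<index>" 50) where
  "u \<sqsubseteq>\<^bsub>V\<^esub> v \<longleftrightarrow> u \<sqinter>\<^bsub>V\<^esub> v = u"

text \<open>
  The identity on the set of all variables is not in \<^const>\<open>T_fp\<close>, so the action says nothing about
  it; by convention it acts trivially. This is needed to state axiom \<open>A8\<close> for the bottom element,
  whose domain is the set of all variables.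
\<close>

definition proj :: "('a, 'm) orbital_alg_scheme \<Rightarrow> 'a \<Rightarrow> var set \<Rightarrow> 'a" where
  "proj V u X = (if X = UNIV then u else u \<cdot>\<^bsub>V\<^esub> pid X)"

locale orbital_semilattice =
  fixes V :: "('a, 'm) orbital_alg_scheme" (structure)
  assumes meet_closed: "\<lbrakk>u \<in> carrier V; v \<in> carrier V\<rbrakk> \<Longrightarrow> u \<sqinter> v \<in> carrier V"
    and zero_closed: "\<zero> \<in> carrier V"
    and one_closed: "\<one> \<in> carrier V"
    and act_closed: "\<lbrakk>u \<in> carrier V; \<nu> \<in> T_fp\<rbrakk> \<Longrightarrow> u \<cdot> \<nu> \<in> carrier V"
    and diag_closed: "diag V x y \<in> carrier V"
    and meet_assoc: "\<lbrakk>u \<in> carrier V; v \<in> carrier V; w \<in> carrier V\<rbrakk>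
      \<Longrightarrow> (u \<sqinter> v) \<sqinter> w = u \<sqinter> (v \<sqinter> w)"
    and meet_comm: "\<lbrakk>u \<in> carrier V; v \<in> carrier V\<rbrakk> \<Longrightarrow> u \<sqinter> v = v \<sqinter> u"
    and meet_idem: "u \<in> carrier V \<Longrightarrow> u \<sqinter> u = u"
    and zero_least: "u \<in> carrier V \<Longrightarrow> \<zero> \<sqsubseteq> u"
    and one_greatest: "u \<in> carrier V \<Longrightarrow> u \<sqsubseteq> \<one>"
    and A1: "\<lbrakk>u \<in> carrier V; u \<noteq> \<zero>\<rbrakk> \<Longrightarrow> u \<cdot> pid {} = \<one>"
    and A2: "\<nu> \<in> T_fp \<Longrightarrow> \<zero> \<cdot> \<nu> = \<zero>"
    and A3: "\<lbrakk>u \<in> carrier V; v \<in> carrier V; finite Y; odom V u \<subseteq> Y\<rbrakk>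
      \<Longrightarrow> (u \<sqinter> v) \<cdot> pid Y = u \<sqinter> v \<cdot> pid Y"
    and A4: "\<lbrakk>u \<in> carrier V; finite Y\<rbrakk> \<Longrightarrow> u \<sqsubseteq> u \<cdot> pid Y"
    and A5: "\<lbrakk>u \<in> carrier V; v \<in> carrier V; \<nu> \<in> T_fp; u \<sqsubseteq> v\<rbrakk> \<Longrightarrow> u \<cdot> \<nu> \<sqsubseteq> v \<cdot> \<nu>"
    and A6: "\<lbrakk>u \<in> carrier V; u \<noteq> \<zero>; u \<sqsubseteq> diag V x y; x \<noteq> y\<rbrakk>
      \<Longrightarrow> u = (u \<cdot> pid (odom V u - {y})) \<sqinter> diag V x y"
    and A7: "\<lbrakk>u \<in> carrier V; \<nu> \<in> T_fp; \<mu> \<in> T_fp\<rbrakk> \<Longrightarrow> (u \<cdot> \<nu>) \<cdot> \<mu> = u \<cdot> (\<nu> \<circ>\<^sub>m \<mu>)"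
    and A8: "u \<in> carrier V \<Longrightarrow> proj V u (odom V u) = u"
    and A9: "diag V x x \<noteq> \<zero>"
    and A10: "diag V x y = diag V x x \<cdot> [x \<mapsto> x, y \<mapsto> x]"
    and A11: "\<lbrakk>u \<in> carrier V; \<nu> \<in> T_fp; u \<noteq> \<zero>\<rbrakk>
      \<Longrightarrow> odom V (u \<cdot> \<nu>) = pmap_vimage \<nu> (odom V u)"
    and A12: "\<lbrakk>u \<in> carrier V; u \<noteq> \<zero>\<rbrakk> \<Longrightarrow> finite (odom V u)"
    and A13: "u \<in> carrier V \<Longrightarrow> odom V u = {x. u \<sqsubseteq> diag V x x}"

definition orbital_hom ::
    "('a, 'm) orbital_alg_scheme \<Rightarrow> ('b, 'n) orbital_alg_scheme \<Rightarrow> ('a \<Rightarrow> 'b) set" where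
  "orbital_hom V W = {\<phi>. \<phi> \<in> carrier V \<rightarrow> carrier W \<and>
     (\<forall>u\<in>carrier V. \<forall>v\<in>carrier V. \<phi> (u \<sqinter>\<^bsub>V\<^esub> v) = \<phi> u \<sqinter>\<^bsub>W\<^esub> \<phi> v) \<and>
     \<phi> \<zero>\<^bsub>V\<^esub> = \<zero>\<^bsub>W\<^esub> \<and>
     \<phi> \<one>\<^bsub>V\<^esub> = \<one>\<^bsub>W\<^esub> \<and>
     (\<forall>x y. \<phi> (diag V x y) = diag W x y) \<and>
     (\<forall>u\<in>carrier V. \<forall>\<nu>\<in>T_fp. \<phi> (u \<cdot>\<^bsub>V\<^esub> \<nu>) = \<phi> u \<cdot>\<^bsub>W\<^esub> \<nu>) \<and>
     (\<forall>u\<in>carrier V. odom W (\<phi> u) = odom V u)}"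

definition orbital_embedding ::
    "('a, 'm) orbital_alg_scheme \<Rightarrow> ('b, 'n) orbital_alg_scheme \<Rightarrow> ('a \<Rightarrow> 'b) set" where
  "orbital_embedding V W = {\<phi> \<in> orbital_hom V W. inj_on \<phi> (carrier V)}"


section \<open>Table algebras\<close>

definition tuples :: "'g set \<Rightarrow> var set \<Rightarrow> (var \<rightharpoonup> 'g) set" where
  "tuples G X = {t. dom t = X \<and> ran t \<subseteq> G}"

definition Tab :: "'g set \<Rightarrow> (var \<rightharpoonup> 'g) set set" where
  "Tab G = (\<Union>X\<in>{X. finite X}. Pow (tuples G X))"

definition schema :: "(var \<rightharpoonup> 'g) set \<Rightarrow> var set" where
  "schema T = (if T = {} then UNIV else (THE X. \<forall>t\<in>T. dom t = X))"

definition join :: "'g set \<Rightarrow> (var \<rightharpoonup> 'g) set \<Rightarrow> (var \<rightharpoonup> 'g) set \<Rightarrow> (var \<rightharpoonup> 'g) set" where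
  "join G T1 T2 = {t \<in> tuples G (schema T1 \<union> schema T2). t |` schema T1 \<in> T1 \<and> t |` schema T2 \<in> T2}"

definition tab_act :: "(var \<rightharpoonup> 'g) set \<Rightarrow> (var \<rightharpoonup> var) \<Rightarrow> (var \<rightharpoonup> 'g) set" where
  "tab_act T \<nu> = {t \<circ>\<^sub>m \<nu> | t. t \<in> T}"

definition tab_diag :: "'g set \<Rightarrow> var \<Rightarrow> var \<Rightarrow> (var \<rightharpoonup> 'g) set" where
  "tab_diag G x y = {t \<in> tuples G {x, y}. t x = t y}"

definition table_algebra :: "'g set \<Rightarrow> (var \<rightharpoonup> 'g) set orbital_alg" where
  "table_algebra G = \<lparr>carrier = Tab G, meet = join G, zero = {}, one = {Map.empty},
     act = tab_act, diag = tab_diag G, odom = schema\<rparr>"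

text \<open>
  HOL cannot quantify existentially over types, so a theorem asserting the existence of a base set
  \<open>G\<close> for an orbital semilattice over \<open>'a\<close> has to name a type for the elements of \<open>G\<close>. Lists over
  \<open>'a + nat\<close> are enough: a representation by tables is a first-order structure with one relation
  for each nonzero element of the semilattice, and being an embedding is a first-order property of
  that structure, so by the downward Loewenheim-Skolem theorem a representation over any base set
  yields one over a base set of cardinality at most that of \<open>'a + nat\<close>.
\<close>


subsection \<open>Table algebras are orbital semilattices\<close>

lemma schema_eq: "T \<subseteq> tuples G X \<Longrightarrow> T \<noteq> {} \<Longrightarrow> schema T = X"
  unfolding schema_def tuples_def by (auto intro!: the_equality)

lemma schema_empty[simp]: "schema {} = UNIV" by (simp add: schema_def)

lemma TabI: "finite X \<Longrightarrow> T \<subseteq> tuples G X \<Longrightarrow> T \<in> Tab G" unfolding Tab_def by blast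
lemma empty_Tab[simp]: "{} \<in> Tab G" by (rule TabI[of "{}"]) auto

lemma TabE: assumes "T \<in> Tab G" "T \<noteq> {}"
  shows "finite (schema T)" "T \<subseteq> tuples G (schema T)"
proof -
  obtain X where "finite X" "T \<subseteq> tuples G X" using assms unfolding Tab_def by blast
  then show "finite (schema T)" "T \<subseteq> tuples G (schema T)" using schema_eq[of T G X] assms(2) by auto
qed

lemma Tab_sub: assumes "T \<in> Tab G" shows "T \<subseteq> tuples G (schema T)"
  using assms TabE(2)[of T G] by (cases "T = {}") auto

lemma join_empty[simp]: "join G {} T = {}" "join G T {} = {}" by (auto simp: join_def)

lemma join_tuples: "join G T U \<subseteq> tuples G (schema T \<union> schema U)"
  by (auto simp: join_def)

lemma join_schema: "join G T U \<noteq> {} \<Longrightarrow> schema (join G T U) = schema T \<union> schema U"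
  using schema_eq join_tuples by metis

lemma join_Tab: assumes "T \<in> Tab G" "U \<in> Tab G" shows "join G T U \<in> Tab G"
proof (cases "T = {} \<or> U = {}")
  case True then show ?thesis by auto
next
  case False then have "finite (schema T \<union> schema U)" using TabE assms by blast
  then show ?thesis using join_tuples unfolding Tab_def by blast
qed

lemma join_comm: "join G T U = join G U T"
  unfolding join_def by (auto simp: Un_commute)

lemma restr_dom: "t |` X = t" if "dom t \<subseteq> X"
  using that by (auto simp: restrict_map_def fun_eq_iff) (metis domIff subsetD)

lemma restr_tup: "t \<in> tuples G X \<Longrightarrow> Y \<subseteq> X \<Longrightarrow> t |` Y \<in> tuples G Y"
  unfolding tuples_def by (auto simp: restrict_map_def ran_def split: if_splits)

lemma join_idem: assumes "T \<in> Tab G" shows "join G T T = T"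
proof -
  have "\<And>t. t \<in> tuples G (schema T) \<Longrightarrow> t |` schema T = t" by (auto simp: tuples_def intro!: restr_dom)
  then show ?thesis unfolding join_def using Tab_sub[OF assms] by auto
qed

lemma join_assoc: assumes "T \<in> Tab G" "U \<in> Tab G" "W \<in> Tab G"
  shows "join G (join G T U) W = join G T (join G U W)"
proof -
  have *: "join G (join G T U) W = {t \<in> tuples G (schema T \<union> schema U \<union> schema W). 
     t |` schema T \<in> T \<and> t |` schema U \<in> U \<and> t |` schema W \<in> W}"  (is "_ = ?R T U W") 
    if "T \<in> Tab G" "U \<in> Tab G" "W \<in> Tab G" for T U W
  proof (cases "join G T U = {}")
    case False
    have r: "\<And>t. (t |` (schema T \<union> schema U)) |` schema T = t |` schema T"
        "\<And>t. (t |` (schema T \<union> schema U)) |` schema U = t |` schema U"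
      by (auto simp: restrict_restrict Int_absorb1)
    show ?thesis unfolding join_def[of G "join G T U"] join_schema[OF False]
      by (auto simp: join_def r intro!: restr_tup)
  next
    case True
    have r: "\<And>t. (t |` (schema T \<union> schema U)) |` schema T = t |` schema T"
        "\<And>t. (t |` (schema T \<union> schema U)) |` schema U = t |` schema U"
      by (auto simp: restrict_restrict Int_absorb1)
    have "?R T U W = {}"
    proof (rule ccontr)
      assume "?R T U W \<noteq> {}"
      then obtain t where t: "t \<in> ?R T U W" by blast
      have "t |` (schema T \<union> schema U) \<in> join G T U" using t
        by (auto simp: join_def r intro!: restr_tup[of _ _ "schema T \<union> schema U \<union> schema W"])
      then show False using True by simp
    qed
    then show ?thesis using True by simp
  qed
  have "join G T (join G U W) = join G (join G U W) T" by (rule join_comm)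
  then show ?thesis using *[OF assms] *[OF assms(2,3,1)] by (auto simp: ac_simps)
qed

lemma le_iff: assumes "T \<in> Tab G" "U \<in> Tab G"
  shows "join G T U = T \<longleftrightarrow> T = {} \<or> (schema U \<subseteq> schema T \<and> (\<forall>t\<in>T. t |` schema U \<in> U))"
proof (cases "T = {}")
  case False
  show ?thesis
  proof
    assume *: "join G T U = T"
    then have "schema T = schema T \<union> schema U" using join_schema[of G T U] False by simp
    then show "T = {} \<or> (schema U \<subseteq> schema T \<and> (\<forall>t\<in>T. t |` schema U \<in> U))"
      using * by (auto simp: join_def)
  next
    assume "T = {} \<or> (schema U \<subseteq> schema T \<and> (\<forall>t\<in>T. t |` schema U \<in> U))"
    then have a: "schema T \<union> schema U = schema T" "\<forall>t\<in>T. t |` schema U \<in> U" using False by auto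
    have "\<And>t. t \<in> tuples G (schema T) \<Longrightarrow> t |` schema T = t" by (auto simp: tuples_def intro!: restr_dom)
    then show "join G T U = T" using Tab_sub[OF assms(1)] a unfolding join_def by auto
  qed
qed simp

lemma act_empty[simp]: "tab_act {} l = {}" by (auto simp: tab_act_def)
lemma act_ne[simp]: "tab_act T l = {} \<longleftrightarrow> T = {}" by (auto simp: tab_act_def)

lemma comp_tup: assumes "t \<in> tuples G X" shows "t \<circ>\<^sub>m l \<in> tuples G (pmap_vimage l X)"
  using assms unfolding tuples_def pmap_vimage_def map_comp_def
  by (auto simp: ran_def dom_def split: option.splits)

lemma act_tup: "T \<in> Tab G \<Longrightarrow> tab_act T l \<subseteq> tuples G (pmap_vimage l (schema T))"
  using comp_tup Tab_sub unfolding tab_act_def by fast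

lemma act_schema: "T \<in> Tab G \<Longrightarrow> T \<noteq> {} \<Longrightarrow> schema (tab_act T l) = pmap_vimage l (schema T)"
  using act_tup schema_eq by (metis act_ne)

lemma act_Tab: assumes "T \<in> Tab G" "l \<in> T_fp" shows "tab_act T l \<in> Tab G"
proof -
  have "pmap_vimage l (schema T) \<subseteq> dom l" by (auto simp: pmap_vimage_def)
  then have "finite (pmap_vimage l (schema T))" using assms(2) finite_subset by (auto simp: T_fp_def)
  then show ?thesis using act_tup[OF assms(1)] unfolding Tab_def by blast
qed

lemma comp_pid: "t \<circ>\<^sub>m pid X = t |` X" by (auto simp: map_comp_def pid_def restrict_map_def)

lemma act_pid: "tab_act T (pid X) = (\<lambda>t. t |` X) ` T" by (auto simp: tab_act_def comp_pid)

lemma pid_fp: "finite Y \<Longrightarrow> pid Y \<in> T_fp" by (auto simp: T_fp_def pid_def dom_def)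
lemma vim_pid[simp]: "pmap_vimage (pid Y) X = X \<inter> Y" by (auto simp: pmap_vimage_def pid_def split: if_splits)

lemma comp_assoc: "(t \<circ>\<^sub>m l) \<circ>\<^sub>m m = t \<circ>\<^sub>m (l \<circ>\<^sub>m m)"
  by (auto simp: map_comp_def split: option.splits)

lemma diag_schema: assumes "G \<noteq> {}" shows "tab_diag G x y \<noteq> {}" "schema (tab_diag G x y) = {x,y}" "tab_diag G x y \<in> Tab G"
proof -
  obtain g where g: "g \<in> G" using assms by blast
  have "[x \<mapsto> g, y \<mapsto> g] \<in> tab_diag G x y" using g by (auto simp: tab_diag_def tuples_def ran_def)
  then show "tab_diag G x y \<noteq> {}" by blast
  then show "schema (tab_diag G x y) = {x,y}" using schema_eq[of "tab_diag G x y" G "{x,y}"] by (auto simp: tab_diag_def)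
  show "tab_diag G x y \<in> Tab G" by (rule TabI[of "{x,y}"]) (auto simp: tab_diag_def)
qed

lemma diag_le: assumes "G \<noteq> {}" "T \<in> Tab G" 
  shows "join G T (tab_diag G x y) = T \<longleftrightarrow> T = {} \<or> ({x,y} \<subseteq> schema T \<and> (\<forall>t\<in>T. t x = t y))"
  unfolding le_iff[OF assms(2) diag_schema(3)[OF assms(1)]] diag_schema(2)[OF assms(1)]
  using Tab_sub[OF assms(2)] restr_tup[of _ G "schema T" "{x,y}"]
  by (auto simp: tab_diag_def subset_iff)

lemma schema_one: "schema {Map.empty} = {}" using schema_eq[of "{Map.empty}" UNIV "{}"] by (auto simp: tuples_def)

lemma table_algebra_orbital:
  assumes G: "G \<noteq> {}" shows "orbital_semilattice (table_algebra G)"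
proof
  let ?A = "table_algebra G"
  note [simp] = table_algebra_def ole_def
  show "u \<in> carrier ?A \<Longrightarrow> v \<in> carrier ?A \<Longrightarrow> u \<sqinter>\<^bsub>?A\<^esub> v \<in> carrier ?A" for u v by (simp add: join_Tab)
  show "\<zero>\<^bsub>?A\<^esub> \<in> carrier ?A" by simp
  show one: "\<one>\<^bsub>?A\<^esub> \<in> carrier ?A" using TabI[of "{}" "{Map.empty}" G] by (simp add: tuples_def)
  show "u \<in> carrier ?A \<Longrightarrow> l \<in> T_fp \<Longrightarrow> u \<cdot>\<^bsub>?A\<^esub> l \<in> carrier ?A" for u l by (simp add: act_Tab)
  show "diag ?A x y \<in> carrier ?A" for x y using diag_schema[OF G] by simp
  show "u \<in> carrier ?A \<Longrightarrow> v \<in> carrier ?A \<Longrightarrow> w \<in> carrier ?A \<Longrightarrow>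
    u \<sqinter>\<^bsub>?A\<^esub> v \<sqinter>\<^bsub>?A\<^esub> w = u \<sqinter>\<^bsub>?A\<^esub> (v \<sqinter>\<^bsub>?A\<^esub> w)" for u v w by (simp add: join_assoc)
  show "u \<sqinter>\<^bsub>?A\<^esub> v = v \<sqinter>\<^bsub>?A\<^esub> u" for u v by (simp add: join_comm)
  show "u \<in> carrier ?A \<Longrightarrow> u \<sqinter>\<^bsub>?A\<^esub> u = u" for u by (simp add: join_idem)
  show "\<zero>\<^bsub>?A\<^esub> \<sqsubseteq>\<^bsub>?A\<^esub> u" for u by simp
  show "u \<in> carrier ?A \<Longrightarrow> u \<sqsubseteq>\<^bsub>?A\<^esub> \<one>\<^bsub>?A\<^esub>" for u using one by (simp add: le_iff schema_one)
  show "u \<in> carrier ?A \<Longrightarrow> u \<noteq> \<zero>\<^bsub>?A\<^esub> \<Longrightarrow> u \<cdot>\<^bsub>?A\<^esub> pid {} = \<one>\<^bsub>?A\<^esub>" for u by (auto simp: act_pid)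
  show "\<zero>\<^bsub>?A\<^esub> \<cdot>\<^bsub>?A\<^esub> l = \<zero>\<^bsub>?A\<^esub>" for l by simp
  show "(u \<sqinter>\<^bsub>?A\<^esub> v) \<cdot>\<^bsub>?A\<^esub> pid Y = u \<sqinter>\<^bsub>?A\<^esub> v \<cdot>\<^bsub>?A\<^esub> pid Y"
    if a: "u \<in> carrier ?A" "v \<in> carrier ?A" "finite Y" "odom ?A u \<subseteq> Y" for u v Y
  proof (cases "u = {} \<or> v = {}")
    case False
    have vT: "v \<in> Tab G" and uT: "u \<in> Tab G" and uY: "schema u \<subseteq> Y" using a by auto
    let ?S = "schema u" and ?R = "schema v"
    have s: "schema ((\<lambda>t. t |` Y) ` v) = ?R \<inter> Y" using act_schema[OF vT, of "pid Y"] False by (simp add: act_pid)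
    have "(\<lambda>t. t |` Y) ` join G u v = join G u ((\<lambda>t. t |` Y) ` v)"
    proof (intro equalityI subsetI)
      fix s assume "s \<in> (\<lambda>t. t |` Y) ` join G u v"
      then obtain t where t: "t \<in> join G u v" "s = t |` Y" by blast
      have tt: "t \<in> tuples G (?S \<union> ?R)" "t |` ?S \<in> u" "t |` ?R \<in> v" using t by (auto simp: join_def)
      have "s = t |` (?S \<union> ?R \<inter> Y)" 
        using tt(1) uY t(2) by (auto simp: restrict_map_def fun_eq_iff tuples_def dom_def) 
      then have 1: "s \<in> tuples G (?S \<union> ?R \<inter> Y)" using restr_tup[OF tt(1), of "?S \<union> ?R \<inter> Y"] by auto
      have 2: "s |` ?S = t |` ?S" using uY t by (simp add: Int_absorb1)
      have 3: "s |` (?R \<inter> Y) = (t |` ?R) |` Y" using t(2) by (auto simp: restrict_map_def fun_eq_iff)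
      show "s \<in> join G u ((\<lambda>t. t |` Y) ` v)" unfolding join_def s 
        using 1 2 tt image_eqI[where f="\<lambda>t. t |` Y", OF 3 tt(3)] by (simp only: mem_Collect_eq simp_thms)
    next
      fix s assume s': "s \<in> join G u ((\<lambda>t. t |` Y) ` v)"
      then obtain r where r: "s \<in> tuples G (?S \<union> ?R \<inter> Y)" "s |` ?S \<in> u" "s |` (?R \<inter> Y) = r |` Y" "r \<in> v"
        unfolding join_def s by auto
      have rt: "r \<in> tuples G ?R" using r Tab_sub[OF vT] by blast
      let ?t = "r ++ s"
      have ag: "s x = r x" if "x \<in> ?R" "x \<in> Y" for x using fun_cong[OF r(3), of x] that by simp
      have sS: "x \<in> ?S \<Longrightarrow> s x \<noteq> None" for x using r(1) by (auto simp: tuples_def)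
      have t1: "?t |` ?S = s |` ?S"
      proof
        fix x show "(?t |` ?S) x = (s |` ?S) x" using sS[of x]
          by (cases "x \<in> ?S"; cases "s x") (auto simp: restrict_map_def map_add_def)
      qed
      have sd: "s x \<noteq> None \<Longrightarrow> x \<in> Y" for x using r(1) uY by (auto simp: tuples_def dom_def)
      have rN: "x \<notin> ?R \<Longrightarrow> r x = None" for x using rt by (auto simp: tuples_def)
      have g1: "x \<in> ?R \<Longrightarrow> s x = Some a \<Longrightarrow> r x = Some a" for x a using ag[of x] sd[of x] by simp
      have g2: "x \<in> Y \<Longrightarrow> s x = None \<Longrightarrow> r x = None" for x using ag[of x] rN[of x] by (cases "x \<in> ?R") auto
      have g3: "x \<notin> Y \<Longrightarrow> s x = None" for x using sd[of x] by blast
      have t2: "?t |` ?R = r"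
      proof
        fix x show "(?t |` ?R) x = r x" using g1[of x] rN[of x]
          by (cases "x \<in> ?R"; cases "s x") (simp_all add: restrict_map_def map_add_def)
      qed
      have t3: "?t |` Y = s"
      proof
        fix x show "(?t |` Y) x = s x" using g2[of x] g3[of x]
          by (cases "x \<in> Y"; cases "s x") (simp_all add: restrict_map_def map_add_def)
      qed
      have "?t \<in> tuples G (?S \<union> ?R)" using r(1) rt ran_map_add by (auto simp: tuples_def ran_def map_add_Some_iff) 
      then have "?t \<in> join G u v" using t1 t2 r by (auto simp: join_def)
      then show "s \<in> (\<lambda>t. t |` Y) ` join G u v" using t3 by (metis image_eqI)
    qed
    then show ?thesis by (simp add: act_pid)
  qed auto
  show "u \<sqsubseteq>\<^bsub>?A\<^esub> u \<cdot>\<^bsub>?A\<^esub> pid Y" if "u \<in> carrier ?A" "finite Y" for u Y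
  proof (cases "u = {}")
    case False
    have u: "u \<in> Tab G" using that by simp
    have "t |` (schema u \<inter> Y) = t |` Y" if "t \<in> u" for t
    proof -
      have "t \<in> tuples G (schema u)" using that Tab_sub[OF u] by blast
      then have "x \<notin> schema u \<Longrightarrow> t x = None" for x by (auto simp: tuples_def)
      then show ?thesis by (auto simp: restrict_map_def fun_eq_iff)
    qed
    then show ?thesis using le_iff[OF u act_Tab[OF u pid_fp[OF that(2)]]] act_schema[OF u False, of "pid Y"] 
      by (auto simp: act_pid)
  qed simp
  show "u \<cdot>\<^bsub>?A\<^esub> l \<sqsubseteq>\<^bsub>?A\<^esub> v \<cdot>\<^bsub>?A\<^esub> l" if a: "u \<in> carrier ?A" "v \<in> carrier ?A" "l \<in> T_fp" "u \<sqsubseteq>\<^bsub>?A\<^esub> v" for u v l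
  proof (cases "u = {}")
    case False
    have T: "u \<in> Tab G" "v \<in> Tab G" using a by auto
    have uv: "schema v \<subseteq> schema u" "\<And>t. t \<in> u \<Longrightarrow> t |` schema v \<in> v" using a(4) False le_iff[OF T] by auto
    then have v: "v \<noteq> {}" using False by blast
    have "(t \<circ>\<^sub>m l) |` pmap_vimage l (schema v) = (t |` schema v) \<circ>\<^sub>m l" for t
      by (auto simp: restrict_map_def map_comp_def pmap_vimage_def fun_eq_iff split: option.splits)
    then have "\<forall>t\<in>tab_act u l. t |` schema (tab_act v l) \<in> tab_act v l"
      unfolding act_schema[OF T(2) v] using uv(2) by (auto simp: tab_act_def)
    moreover have "schema (tab_act v l) \<subseteq> schema (tab_act u l)"
      using act_schema[OF T(2) v] act_schema[OF T(1) False] uv(1) by (auto simp: pmap_vimage_def)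
    ultimately show ?thesis using le_iff[OF act_Tab[OF T(1) a(3)] act_Tab[OF T(2) a(3)]] by simp
  qed simp
  show "u = u \<cdot>\<^bsub>?A\<^esub> pid (odom ?A u - {y}) \<sqinter>\<^bsub>?A\<^esub> diag ?A x y"
    if a: "u \<in> carrier ?A" "u \<noteq> \<zero>\<^bsub>?A\<^esub>" "u \<sqsubseteq>\<^bsub>?A\<^esub> diag ?A x y" "x \<noteq> y" for u x y
  proof -
    have u: "u \<in> Tab G" "u \<noteq> {}" using a by auto
    have d: "x \<in> schema u" "y \<in> schema u" "\<And>t. t \<in> u \<Longrightarrow> t x = t y" using a(3) diag_le[OF G u(1)] u(2) by auto
    let ?P = "schema u - {y}"
    have s: "schema ((\<lambda>t. t |` ?P) ` u) = ?P" using act_schema[OF u, of "pid ?P"] by (simp add: act_pid Int_absorb1)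
    have pu: "?P \<union> {x,y} = schema u" using d by auto
    have "join G ((\<lambda>t. t |` ?P) ` u) (tab_diag G x y) = u"
    proof (intro equalityI subsetI)
      fix t assume "t \<in> join G ((\<lambda>t. t |` ?P) ` u) (tab_diag G x y)"
      then obtain r where r: "t \<in> tuples G (schema u)" "t |` ?P = r |` ?P" "r \<in> u" "t x = t y"
        unfolding join_def s diag_schema(2)[OF G] pu by (auto simp: tab_diag_def)
      have rt: "r \<in> tuples G (schema u)" using r Tab_sub[OF u(1)] by blast
      have e: "z \<in> ?P \<Longrightarrow> t z = r z" for z using fun_cong[OF r(2), of z] by (simp add: restrict_map_def split: if_splits)
      have n: "z \<notin> schema u \<Longrightarrow> t z = None" "z \<notin> schema u \<Longrightarrow> r z = None" for z
        using r(1) rt by (auto simp: tuples_def)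
      have "t = r"
      proof
        fix z show "t z = r z"
          using e[of z] e[of x] d(1) a(4) r(4) d(3)[OF r(3)] n[of z]
          by (cases "z \<in> schema u"; cases "z = y") auto
      qed
      then show "t \<in> u" using r by simp
    next
      fix t assume t: "t \<in> u"
      then have tt: "t \<in> tuples G (schema u)" using Tab_sub[OF u(1)] by blast
      then show "t \<in> join G ((\<lambda>t. t |` ?P) ` u) (tab_diag G x y)"
        unfolding join_def s diag_schema(2)[OF G] pu using t d(3)[OF t] restr_tup[OF tt, of "{x,y}"] d by (auto simp: tab_diag_def)
    qed
    then show ?thesis by (simp add: act_pid)
  qed
  show "u \<cdot>\<^bsub>?A\<^esub> l \<cdot>\<^bsub>?A\<^esub> m = u \<cdot>\<^bsub>?A\<^esub> (l \<circ>\<^sub>m m)" for u l m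
    by (auto simp: tab_act_def comp_assoc) (metis comp_assoc)
  show "u \<in> carrier ?A \<Longrightarrow> proj ?A u (odom ?A u) = u" for u
  proof -
    assume "u \<in> carrier ?A"
    then have "\<And>t. t \<in> u \<Longrightarrow> t |` schema u = t" using Tab_sub[of u G] by (auto simp: tuples_def intro!: restr_dom)
    then show ?thesis by (auto simp: proj_def act_pid)
  qed
  show "diag ?A x x \<noteq> \<zero>\<^bsub>?A\<^esub>" for x using diag_schema[OF G] by simp
  show "diag ?A x y = diag ?A x x \<cdot>\<^bsub>?A\<^esub> [x \<mapsto> x, y \<mapsto> x]" for x y
  proof -
    have "tab_diag G x y \<subseteq> tab_act (tab_diag G x x) [x \<mapsto> x, y \<mapsto> x]"
    proof
      fix t assume t: "t \<in> tab_diag G x y"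
      have e: "t = (t |` {x}) \<circ>\<^sub>m [x \<mapsto> x, y \<mapsto> x]" using t
        by (auto simp: tab_diag_def tuples_def map_comp_def fun_eq_iff dom_def)
      have "t |` {x} \<in> tab_diag G x x" using t restr_tup[of t G "{x,y}" "{x}"] by (auto simp: tab_diag_def)
      then show "t \<in> tab_act (tab_diag G x x) [x \<mapsto> x, y \<mapsto> x]" using e by (auto simp: tab_act_def)
    qed
    moreover have "tab_act (tab_diag G x x) [x \<mapsto> x, y \<mapsto> x] \<subseteq> tab_diag G x y"
    proof
      fix t assume "t \<in> tab_act (tab_diag G x x) [x \<mapsto> x, y \<mapsto> x]"
      then obtain r where r: "r \<in> tuples G {x}" "t = r \<circ>\<^sub>m [x \<mapsto> x, y \<mapsto> x]" by (auto simp: tab_act_def tab_diag_def)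
      have "pmap_vimage [x \<mapsto> x, y \<mapsto> x] {x} = {x,y}" by (auto simp: pmap_vimage_def split: if_splits)
      then show "t \<in> tab_diag G x y" using comp_tup[OF r(1), of "[x \<mapsto> x, y \<mapsto> x]"] r(2) by (auto simp: tab_diag_def map_comp_def)
    qed
    ultimately show ?thesis by auto
  qed
  show "u \<in> carrier ?A \<Longrightarrow> u \<noteq> \<zero>\<^bsub>?A\<^esub> \<Longrightarrow> odom ?A (u \<cdot>\<^bsub>?A\<^esub> l) = pmap_vimage l (odom ?A u)" for u l
    by (simp add: act_schema)
  show "u \<in> carrier ?A \<Longrightarrow> u \<noteq> \<zero>\<^bsub>?A\<^esub> \<Longrightarrow> finite (odom ?A u)" for u by (simp add: TabE)
  show "u \<in> carrier ?A \<Longrightarrow> odom ?A u = {x. u \<sqsubseteq>\<^bsub>?A\<^esub> diag ?A x x}" for u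
    using diag_le[OF G] by auto
qed

end

theory Submission
  imports Defs
begin

text \<open>
  This is a Henkin construction. Read \<open>(u, b) \<in> T\<close> as: the structure to be built satisfies \<open>u\<close> under
  the valuation \<open>b\<close>. The projections of an orbital semilattice are existential quantifiers, so a base
  set for the representation needs, whenever \<open>v \<cdot> pid X\<close> holds of \<open>a\<close>, an extension of \<open>a\<close> from \<open>X\<close> that
  satisfies \<open>v\<close>. Adding fresh witnesses freely is conservative: if \<open>w \<sqsubseteq> v \<cdot> pid X\<close> shares only the
  variables \<open>X\<close> with \<open>v\<close>, then \<open>A3\<close> shows that \<open>w \<sqinter> v\<close> projects back to \<open>w\<close>. A theory that is maximal with
  respect to conservative extension therefore has all witnesses. By \<open>A1\<close> every nonzero \<open>v\<close> has the
  true projection \<open>\<one>\<close>, so it too gets a witness, and this one satisfies nothing but the consequences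
  of \<open>v\<close>, whence the injectivity. Identifying elements along the diagonals, which \<open>A6\<close> makes a
  congruence, gives the representation.
\<close>

section \<open>Substitutions and diagonals\<close>

lemma T_fp_empty [simp]: "Map.empty \<in> T_fp"
  and T_fp_upd [simp]: "f \<in> T_fp \<Longrightarrow> f(x \<mapsto> y) \<in> T_fp"
  and T_fp_restrict [simp]: "f \<in> T_fp \<Longrightarrow> f |` Y \<in> T_fp"
  and T_fp_pid [simp]: "finite Y \<Longrightarrow> pid Y \<in> T_fp"
  by (auto simp: pid_fp) (auto simp: T_fp_def)

lemma T_fp_comp [simp]: "g \<in> T_fp \<Longrightarrow> f \<circ>\<^sub>m g \<in> T_fp"
proof -
  have "dom (f \<circ>\<^sub>m g) \<subseteq> dom g" by (auto simp: map_comp_def split: option.splits)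
  then show "g \<in> T_fp \<Longrightarrow> f \<circ>\<^sub>m g \<in> T_fp" by (auto simp: T_fp_def intro: finite_subset)
qed

lemma T_fp_total [simp]: "finite Y \<Longrightarrow> (\<lambda>x. if x \<in> Y then Some (f x) else None) \<in> T_fp"
  by (auto simp: T_fp_def dom_def)

context orbital_semilattice
begin

section \<open>Order, action and domains\<close>

lemma le_refl [simp]: "u \<in> carrier V \<Longrightarrow> u \<sqsubseteq> u"
  by (simp add: ole_def meet_idem)

lemma le_trans:
  assumes "u \<sqsubseteq> v" "v \<sqsubseteq> w" "u \<in> carrier V" "v \<in> carrier V" "w \<in> carrier V"
  shows "u \<sqsubseteq> w"
  using assms by (metis ole_def meet_assoc)

lemma le_antisym: "\<lbrakk>u \<sqsubseteq> v; v \<sqsubseteq> u; u \<in> carrier V; v \<in> carrier V\<rbrakk> \<Longrightarrow> u = v"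
  by (metis ole_def meet_comm)

lemma meet_le1: "\<lbrakk>u \<in> carrier V; v \<in> carrier V\<rbrakk> \<Longrightarrow> u \<sqinter> v \<sqsubseteq> u"
  by (metis ole_def meet_assoc meet_comm meet_idem meet_closed)

lemma meet_le2: "\<lbrakk>u \<in> carrier V; v \<in> carrier V\<rbrakk> \<Longrightarrow> u \<sqinter> v \<sqsubseteq> v"
  by (metis ole_def meet_assoc meet_idem)

lemma meet_glb: "\<lbrakk>w \<sqsubseteq> u; w \<sqsubseteq> v; u \<in> carrier V; v \<in> carrier V; w \<in> carrier V\<rbrakk> \<Longrightarrow> w \<sqsubseteq> u \<sqinter> v"
  by (metis ole_def meet_assoc)

lemma meet_mono:
  assumes "u \<sqsubseteq> u'" "v \<sqsubseteq> v'" "u \<in> carrier V" "v \<in> carrier V" "u' \<in> carrier V" "v' \<in> carrier V"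
  shows "u \<sqinter> v \<sqsubseteq> u' \<sqinter> v'"
  using assms by (meson meet_glb meet_le1 meet_le2 le_trans meet_closed)

lemma le_zero: "\<lbrakk>u \<sqsubseteq> \<zero>; u \<in> carrier V\<rbrakk> \<Longrightarrow> u = \<zero>"
  using le_antisym zero_least zero_closed by blast

lemma one_nonzero: "\<one> \<noteq> \<zero>"
  by (metis A9 diag_closed one_greatest le_zero)

text \<open>Any substitution followed by \<open>pid {}\<close> is \<open>pid {}\<close>, so by
  \<open>A1\<close> a nonzero element still projects to \<open>\<one>\<close> after any action,
  whereas \<open>\<zero>\<close> does not.\<close>

lemma act_nonzero:
  assumes "u \<in> carrier V" "f \<in> T_fp" "u \<noteq> \<zero>"
  shows "u \<cdot> f \<noteq> \<zero>"
proof
  assume *: "u \<cdot> f = \<zero>"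
  have "f \<circ>\<^sub>m pid {} = pid {}" by (auto simp: pid_def map_comp_def)
  then have "(u \<cdot> f) \<cdot> pid {} = \<one>" using A7[of u f "pid {}"] A1 assms by simp
  then show False using * A2[of "pid {}"] one_nonzero by simp
qed

lemma nonzero_mono: "\<lbrakk>u \<sqsubseteq> v; u \<noteq> \<zero>; u \<in> carrier V; v \<in> carrier V\<rbrakk> \<Longrightarrow> v \<noteq> \<zero>"
  using le_zero by blast

lemma odom_antimono: "\<lbrakk>u \<sqsubseteq> v; u \<in> carrier V; v \<in> carrier V\<rbrakk> \<Longrightarrow> odom V v \<subseteq> odom V u"
  using le_trans diag_closed by (auto simp: A13)

text \<open>By \<open>A8\<close> a nonzero \<open>u\<close> absorbs the projection onto its own
  domain, and composing with that projection erases every value of a substitution outside the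
  domain.\<close>

lemma act_cong:
  assumes "u \<in> carrier V" "f \<in> T_fp" "g \<in> T_fp"
    and eq: "\<And>x y. y \<in> odom V u \<Longrightarrow> f x = Some y \<longleftrightarrow> g x = Some y"
  shows "u \<cdot> f = u \<cdot> g"
proof (cases "u = \<zero>")
  case True then show ?thesis using assms A2 by simp
next
  case False
  have fin: "finite (odom V u)" using False assms A12 by blast
  then have "odom V u \<noteq> UNIV" by auto
  then have u: "u \<cdot> pid (odom V u) = u" using A8[OF assms(1)] by (simp add: proj_def)
  have "pid (odom V u) \<circ>\<^sub>m f = pid (odom V u) \<circ>\<^sub>m g"
  proof
    fix x
    show "(pid (odom V u) \<circ>\<^sub>m f) x = (pid (odom V u) \<circ>\<^sub>m g) x"
      using eq[of _ x] by (cases "f x"; cases "g x") (auto simp: map_comp_def pid_def)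
  qed
  then show ?thesis using A7[of u "pid (odom V u)"] u assms fin by (metis T_fp_pid)
qed

lemma act_pid_eq: "\<lbrakk>u \<in> carrier V; finite Y; odom V u \<subseteq> Y\<rbrakk> \<Longrightarrow> u \<cdot> pid Y = u"
proof (cases "u = \<zero>")
  case False
  assume a: "u \<in> carrier V" "finite Y" "odom V u \<subseteq> Y"
  then have fin: "finite (odom V u)" by (blast intro: finite_subset)
  then have "odom V u \<noteq> UNIV" by auto
  then have "u \<cdot> pid (odom V u) = u" using A8[OF a(1)] by (simp add: proj_def)
  moreover have "u \<cdot> pid Y = u \<cdot> pid (odom V u)"
    using a fin by (intro act_cong) (auto simp: pid_def)
  ultimately show ?thesis by simp
qed (simp add: A2)

text \<open>Restricting a substitution amounts to projecting after it, so this is \<open>A4\<close>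
  for \<open>u \<cdot> f\<close>: forgetting variables can only weaken.\<close>

lemma act_le_restrict:
  assumes "u \<in> carrier V" "f \<in> T_fp"
  shows "u \<cdot> f \<sqsubseteq> u \<cdot> (f |` Y)"
proof -
  have fin: "finite (Y \<inter> dom f)" using assms by (simp add: T_fp_def)
  have "f \<circ>\<^sub>m pid (Y \<inter> dom f) = f |` Y" by (auto simp: comp_pid restrict_map_def fun_eq_iff dom_def)
  then show ?thesis
    using A4[OF act_closed[OF assms] fin] A7[OF assms T_fp_pid[OF fin]] by simp
qed

lemma act_le_weaken:
  assumes "u \<in> carrier V" "f \<in> T_fp" "v \<in> carrier V" "u \<cdot> (f |` Y) \<sqsubseteq> v"
  shows "u \<cdot> f \<sqsubseteq> v"
  using assms act_le_restrict le_trans act_closed T_fp_restrict by meson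

lemma act_le_act_mono:
  assumes "w \<cdot> g \<sqsubseteq> u" "w \<in> carrier V" "u \<in> carrier V" "f \<in> T_fp" "g \<in> T_fp"
  shows "w \<cdot> (g \<circ>\<^sub>m f) \<sqsubseteq> u \<cdot> f"
  using A5[OF act_closed[of w g] assms(3,4,1)] A7[of w g f] assms by simp

lemma odom_one [simp]: "odom V \<one> = {}"
proof -
  have "\<one> \<cdot> pid {} = \<one>" using A1 one_closed one_nonzero by blast
  then show ?thesis using A11[of \<one> "pid {}"] one_closed one_nonzero by simp
qed

lemma odom_empty: "\<lbrakk>u \<in> carrier V; u \<noteq> \<zero>; odom V u = {}\<rbrakk> \<Longrightarrow> u = \<one>"
  using A1 act_pid_eq by force

lemma odom_act_pid:
  "\<lbrakk>u \<in> carrier V; u \<noteq> \<zero>; finite X\<rbrakk> \<Longrightarrow> odom V (u \<cdot> pid X) = odom V u \<inter> X"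
  by (simp add: A11)

text \<open>For the upper bound take the union of both domains for \<open>Y\<close> in
  \<open>A3\<close>: the projection passes on to \<open>v\<close>, which it fixes, so the meet is
  fixed too.\<close>

lemma odom_meet:
  assumes "u \<in> carrier V" "v \<in> carrier V" "u \<sqinter> v \<noteq> \<zero>"
  shows "odom V (u \<sqinter> v) = odom V u \<union> odom V v"
proof
  note c = meet_closed[OF assms(1,2)]
  show "odom V u \<union> odom V v \<subseteq> odom V (u \<sqinter> v)"
    using odom_antimono[OF meet_le1 c] odom_antimono[OF meet_le2 c] assms by blast
  have "u \<noteq> \<zero>" "v \<noteq> \<zero>"
    using nonzero_mono[OF meet_le1 assms(3) c] nonzero_mono[OF meet_le2 assms(3) c] assms by auto
  then have fin: "finite (odom V u \<union> odom V v)" using A12 assms by blast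
  have "(u \<sqinter> v) \<cdot> pid (odom V u \<union> odom V v) = u \<sqinter> v"
    using A3[OF assms(1,2) fin] act_pid_eq[OF assms(2) fin] by simp
  then show "odom V (u \<sqinter> v) \<subseteq> odom V u \<union> odom V v"
    using odom_act_pid[OF c assms(3) fin] by auto
qed

section \<open>Diagonals and substitution of equals\<close>

lemma odom_diag_same: "odom V (diag V x x) = {x}"
proof
  have "odom V (diag V x x) = pmap_vimage [x \<mapsto> x] (odom V (diag V x x))"
    using A10[of x x] A11[of "diag V x x" "[x \<mapsto> x]"] A9 diag_closed by simp
  then show "odom V (diag V x x) \<subseteq> {x}" by (auto simp: pmap_vimage_def split: if_splits)
  show "{x} \<subseteq> odom V (diag V x x)" by (simp add: A13 diag_closed)
qed

lemma odom_diag: "odom V (diag V x y) = {x, y}"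
  unfolding A10[of x y] using A11[of "diag V x x" "[x \<mapsto> x, y \<mapsto> x]"] A9 diag_closed odom_diag_same
  by (auto simp: pmap_vimage_def split: if_splits)

lemma diag_nonzero: "diag V x y \<noteq> \<zero>"
  unfolding A10[of x y] using act_nonzero diag_closed A9 by simp

text \<open>By \<open>A13\<close> a renamed \<open>diag V a a\<close> lies below the diagonal of the
  new variable. Renaming back turns the same bound into the converse inequality.\<close>

lemma diag_rename: "diag V x x \<cdot> [y \<mapsto> x] = diag V y y"
proof -
  have le: "diag V a a \<cdot> [b \<mapsto> a] \<sqsubseteq> diag V b b" for a b
  proof -
    have "b \<in> odom V (diag V a a \<cdot> [b \<mapsto> a])"
      using A11[of "diag V a a" "[b \<mapsto> a]"] A9 diag_closed odom_diag_same by (auto simp: pmap_vimage_def)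
    then show ?thesis using A13 act_closed diag_closed by simp
  qed
  have "[x \<mapsto> y] \<circ>\<^sub>m [y \<mapsto> x] = pid {y}" by (auto simp: map_comp_def pid_def)
  then have "diag V y y = diag V y y \<cdot> ([x \<mapsto> y] \<circ>\<^sub>m [y \<mapsto> x])"
    using act_pid_eq[of "diag V y y" "{y}"] odom_diag_same diag_closed by simp
  also have "\<dots> \<sqsubseteq> diag V x x \<cdot> [y \<mapsto> x]"
    using act_le_act_mono[OF le] diag_closed by simp
  finally show ?thesis
    using le_antisym[OF le] act_closed[OF diag_closed T_fp_upd[OF T_fp_empty]] diag_closed by blast
qed

lemma diag_eq_act: "diag V z z \<cdot> [x \<mapsto> z, y \<mapsto> z] = diag V x y"
proof -
  have "[x \<mapsto> z] \<circ>\<^sub>m [x \<mapsto> x, y \<mapsto> x] = [x \<mapsto> z, y \<mapsto> z]" by (auto simp: map_comp_def)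
  then show ?thesis
    unfolding A10[of x y] diag_rename[of z x, symmetric] using A7[of "diag V z z"] diag_closed by simp
qed

lemma diag_sym: "diag V x y = diag V y x"
  unfolding diag_eq_act[of x x y, symmetric] diag_eq_act[of x y x, symmetric]
  by (rule act_cong) (auto simp: diag_closed)

lemma diag_act:
  assumes "f \<in> T_fp" "f x = Some p" "f y = Some q" "dom f = {x, y}"
  shows "diag V p q \<cdot> f = diag V x y"
proof -
  have "[p \<mapsto> p, q \<mapsto> p] \<circ>\<^sub>m f = [x \<mapsto> p, y \<mapsto> p]"
  proof
    fix z show "([p \<mapsto> p, q \<mapsto> p] \<circ>\<^sub>m f) z = [x \<mapsto> p, y \<mapsto> p] z"
      using assms by (cases "z \<in> dom f") (auto simp: map_comp_def)
  qed
  then show ?thesis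
    unfolding A10[of p q] using A7[of "diag V p p" "[p \<mapsto> p, q \<mapsto> p]" f] diag_closed assms(1)
    by (simp add: diag_eq_act)
qed

lemma le_diag_act:
  assumes "u \<in> carrier V" "u \<sqsubseteq> diag V p q" "f \<in> T_fp" "f x = Some p" "f y = Some q"
  shows "u \<cdot> f \<sqsubseteq> diag V x y"
proof (rule act_le_weaken[where Y = "{x, y}"])
  have "diag V p q \<cdot> (f |` {x, y}) = diag V x y"
    using assms by (intro diag_act) auto
  then show "u \<cdot> (f |` {x, y}) \<sqsubseteq> diag V x y"
    using A5[OF assms(1) diag_closed _ assms(2), of "f |` {x, y}"] assms by simp
qed (use assms diag_closed in auto)

text \<open>Axiom \<open>A6\<close> says that \<open>u\<close> is determined by its projection forgetting \<open>q\<close>, so \<open>u\<close> is the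
  image of that projection under the substitution that duplicates the column \<open>p\<close>.\<close>

lemma le_diag_eq_act:
  assumes "u \<in> carrier V" "u \<noteq> \<zero>" "u \<sqsubseteq> diag V p q" "p \<noteq> q"
  shows "(u \<cdot> pid (odom V u - {q})) \<cdot> (pid (odom V u))(q \<mapsto> p) = u"
proof -
  let ?w = "u \<cdot> pid (odom V u - {q})" and ?s = "(pid (odom V u))(q \<mapsto> p)"
  have fin: "finite (odom V u)" using assms A12 by blast
  have pq: "p \<in> odom V u" "q \<in> odom V u"
    using odom_antimono[OF assms(3,1) diag_closed] odom_diag by auto
  have w: "?w \<in> carrier V" "?w \<noteq> \<zero>" using assms act_closed act_nonzero fin by auto
  have dw: "odom V ?w = odom V u - {q}" using assms fin by (auto simp: odom_act_pid)
  have s: "?s \<in> T_fp" using fin by simp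
  have wp: "?w \<sqsubseteq> diag V p p" using w dw pq assms by (simp add: A13 set_eq_iff)
  have ws: "?w \<cdot> ?s \<in> carrier V" "?w \<cdot> ?s \<noteq> \<zero>" using w s act_closed act_nonzero by auto
  have "?w \<cdot> ?s \<sqsubseteq> diag V p q"
    using w pq assms(4) by (intro le_diag_act[OF _ wp s]) (auto simp: pid_def)
  \<comment> \<open>\<open>A6\<close> rebuilds an element from its projection forgetting
    \<open>q\<close>; it remains to see that \<open>?w \<cdot> ?s\<close> and \<open>u\<close> have
    the same domain and the same such projection.\<close>
  then have "?w \<cdot> ?s = (?w \<cdot> ?s) \<cdot> pid (odom V (?w \<cdot> ?s) - {q}) \<sqinter> diag V p q"
    by (intro A6 ws assms(4))
  moreover have "odom V (?w \<cdot> ?s) = odom V u"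
    using A11[OF w(1) s w(2)] dw pq assms(4) by (auto simp: pmap_vimage_def pid_def split: if_splits)
  moreover have "(?w \<cdot> ?s) \<cdot> pid (odom V u - {q}) = ?w"
  proof -
    have "(?w \<cdot> ?s) \<cdot> pid (odom V u - {q}) = ?w \<cdot> (?s \<circ>\<^sub>m pid (odom V u - {q}))"
      using w s fin by (intro A7) auto
    also have "?s \<circ>\<^sub>m pid (odom V u - {q}) = pid (odom V u - {q})"
      by (auto simp: map_comp_def pid_def)
    also have "?w \<cdot> pid (odom V u - {q}) = ?w" using w dw fin by (intro act_pid_eq) auto
    finally show ?thesis .
  qed
  ultimately show ?thesis using A6[OF assms] by simp
qed

text \<open>Write \<open>u\<close> as in \<open>le_diag_eq_act\<close>: the duplicating substitution
  sends \<open>p\<close> and \<open>q\<close> alike to \<open>p\<close>, so in the composite it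
  makes no difference which of them \<open>x\<close> is mapped to.\<close>

lemma act_swap:
  assumes "u \<in> carrier V" "u \<sqsubseteq> diag V p q" "f \<in> T_fp" "f x = Some p"
  shows "u \<cdot> f = u \<cdot> f(x \<mapsto> q)"
proof (cases "u = \<zero> \<or> p = q")
  case True then show ?thesis using assms A2 by (metis T_fp_upd fun_upd_triv)
next
  case False
  let ?w = "u \<cdot> pid (odom V u - {q})" and ?s = "(pid (odom V u))(q \<mapsto> p)"
  have fin: "finite (odom V u)" using assms False A12 by blast
  have pq: "p \<in> odom V u" "q \<in> odom V u"
    using odom_antimono[OF assms(2,1) diag_closed] odom_diag by auto
  have e: "?w \<cdot> ?s = u" using le_diag_eq_act assms False by simp
  have w: "?w \<in> carrier V" using assms act_closed fin by auto
  have "?s \<circ>\<^sub>m f = ?s \<circ>\<^sub>m f(x \<mapsto> q)" using assms(4) False pq by (auto simp: map_comp_def pid_def)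
  then show ?thesis using A7[OF w, of ?s f] A7[OF w, of ?s "f(x \<mapsto> q)"] assms fin e by simp
qed

text \<open>The finitely many disagreements between \<open>f\<close> and \<open>g\<close> are
  repaired one variable at a time by \<open>act_swap\<close>.\<close>

lemma act_diag_cong:
  assumes u: "u \<in> carrier V" and "f \<in> T_fp" and g: "g \<in> T_fp" and "dom f = dom g"
    and "\<And>x p q. f x = Some p \<Longrightarrow> g x = Some q \<Longrightarrow> u \<sqsubseteq> diag V p q"
  shows "u \<cdot> f = u \<cdot> g"
proof -
  have *: "u \<cdot> f = u \<cdot> g"
    if "finite D" "{x. f x \<noteq> g x} \<subseteq> D" "f \<in> T_fp" "dom f = dom g"
      "\<And>x p q. x \<in> D \<Longrightarrow> f x = Some p \<Longrightarrow> g x = Some q \<Longrightarrow> u \<sqsubseteq> diag V p q" for D f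
    using that
  proof (induction D arbitrary: f rule: finite_induct)
    case empty
    then have "f = g" by auto
    then show ?case by simp
  next
    case (insert z D)
    show ?case
    proof (cases "g z")
      case None
      then have "f z = g z" using insert.prems(3) by (metis domIff)
      then show ?thesis using insert.prems by (intro insert.IH) (auto, metis)
    next
      case (Some q)
      then obtain p where p: "f z = Some p" using insert.prems(3) by (metis domD domI)
      have "u \<sqsubseteq> diag V p q" using insert.prems(4) p Some by blast
      then have "u \<cdot> f = u \<cdot> f(z \<mapsto> q)" using insert.prems(2) p by (intro act_swap u)
      also have "\<dots> = u \<cdot> g"
      proof (rule insert.IH)
        show "{x. (f(z \<mapsto> q)) x \<noteq> g x} \<subseteq> D" using insert.prems(1) Some by auto
        show "f(z \<mapsto> q) \<in> T_fp" using insert.prems(2) by simp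
        show "dom (f(z \<mapsto> q)) = dom g" using insert.prems(3) Some by (auto simp: insert_absorb)
        show "u \<sqsubseteq> diag V p' q'" if "x \<in> D" "(f(z \<mapsto> q)) x = Some p'" "g x = Some q'" for x p' q'
          using that insert.prems(4)[of x p' q'] insert.hyps(2) by (cases "x = z") auto
      qed
      finally show ?thesis .
    qed
  qed
  have "finite {x. f x \<noteq> g x}"
  proof (rule finite_subset)
    show "{x. f x \<noteq> g x} \<subseteq> dom f" 
      using assms(4) by (metis (mono_tags, lifting) domIff mem_Collect_eq subsetI)
    show "finite (dom f)" using assms(2) by (simp add: T_fp_def)
  qed
  then show ?thesis by (rule *) (use assms in auto)
qed

text \<open>Project \<open>u\<close> to \<open>x\<close> and \<open>z\<close> and use
  \<open>act_swap\<close> to read \<open>z\<close> from \<open>y\<close> instead; the first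
  hypothesis then bounds the result. For \<open>x = z\<close> the claim is that \<open>x\<close>
  lies in the domain.\<close>

lemma le_diag_trans:
  assumes "u \<in> carrier V" "u \<sqsubseteq> diag V x y" "u \<sqsubseteq> diag V y z"
  shows "u \<sqsubseteq> diag V x z"
proof -
  consider "x = z" | "x \<noteq> z" by blast
  then show ?thesis
  proof cases
    case 1
    have "x \<in> odom V u" using odom_antimono[OF assms(2,1) diag_closed] odom_diag by auto
    then show ?thesis using 1 A13[OF assms(1)] by simp
  next
    case 2
    have "u \<sqsubseteq> u \<cdot> pid {x, z}" using A4 assms by simp
    also have "pid {x, z} = [x \<mapsto> x, z \<mapsto> z]" by (auto simp: pid_def)
    also have "u \<cdot> [x \<mapsto> x, z \<mapsto> z] = u \<cdot> [x \<mapsto> x, z \<mapsto> y]"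
      using act_swap[OF assms(1), of z y "[x \<mapsto> x, z \<mapsto> z]" z] assms diag_sym by simp
    finally have 1: "u \<sqsubseteq> u \<cdot> [x \<mapsto> x, z \<mapsto> y]" .
    have "u \<cdot> [x \<mapsto> x, z \<mapsto> y] \<sqsubseteq> diag V x z"
      using 2 assms by (intro le_diag_act[OF assms(1,2)]) auto
    from le_trans[OF 1 this] show ?thesis using act_closed assms(1) diag_closed by simp
  qed
qed

end

section \<open>Theories and free witnesses\<close>

text \<open>Valuations are total, but only their values on the domain of the formula matter.\<close>

locale orbital_theory = orbital_semilattice V
  for V :: "('a, 'm) orbital_alg_scheme" (structure) +
  fixes T :: "('a \<times> (var \<Rightarrow> 'k)) set"
  assumes T_carrier: "(u, b) \<in> T \<Longrightarrow> u \<in> carrier V"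
    and T_nonzero: "(u, b) \<in> T \<Longrightarrow> u \<noteq> \<zero>"
    and T_one: "(\<one>, b) \<in> T"
    and T_up: "\<lbrakk>(u, b) \<in> T; u \<sqsubseteq> v; v \<in> carrier V\<rbrakk> \<Longrightarrow> (v, b) \<in> T"
    and T_meet: "\<lbrakk>(u, b) \<in> T; (v, b) \<in> T\<rbrakk> \<Longrightarrow> (u \<sqinter> v, b) \<in> T"
    and T_act: "\<lbrakk>(u, b) \<in> T; f \<in> T_fp; \<And>x y. f x = Some y \<Longrightarrow> y \<in> odom V u \<Longrightarrow> b' x = b y\<rbrakk>
      \<Longrightarrow> (u \<cdot> f, b') \<in> T"

context orbital_semilattice
begin

text \<open>\<open>diag V x x\<close> acts as an existence predicate: only values satisfying it
  belong to the structure that \<open>T\<close> describes. The variable \<open>0\<close> is an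
  arbitrary choice, by \<open>T_diag_same\<close>.\<close>

definition elems :: "('a \<times> (var \<Rightarrow> 'k)) set \<Rightarrow> 'k set" where
  "elems T = {k. (diag V 0 0, \<lambda>_. k) \<in> T}"

lemma act_restrict_odom_le:
  assumes "w \<cdot> g \<sqsubseteq> u" "w \<in> carrier V" "u \<in> carrier V" "u \<noteq> \<zero>" "g \<in> T_fp"
  shows "w \<cdot> (g |` odom V u) \<sqsubseteq> u"
  using act_le_act_mono[OF assms(1-3) _ assms(5), of "pid (odom V u)"] A12[OF assms(3,4)]
    act_pid_eq[OF assms(3)] by (simp add: comp_pid)

end

section \<open>Valuations, equalities and renaming in a theory\<close>

context orbital_theory
begin

lemma T_finite: "(u, b) \<in> T \<Longrightarrow> finite (odom V u)"
  using T_carrier T_nonzero A12 by blast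

lemma T_cong: "\<lbrakk>(u, b) \<in> T; \<And>x. x \<in> odom V u \<Longrightarrow> b' x = b x\<rbrakk> \<Longrightarrow> (u, b') \<in> T"
proof -
  assume T: "(u, b) \<in> T" and eq: "\<And>x. x \<in> odom V u \<Longrightarrow> b' x = b x"
  have "(u \<cdot> pid (odom V u), b') \<in> T"
    using eq T_finite[OF T] by (intro T_act[OF T]) (auto simp: pid_def split: if_splits)
  then show ?thesis using act_pid_eq[OF T_carrier[OF T] T_finite[OF T]] by simp
qed

lemma T_diag_same: "(diag V x x, b) \<in> T \<longleftrightarrow> b x \<in> elems T"
proof
  assume "(diag V x x, b) \<in> T"
  then have "(diag V x x \<cdot> [0 \<mapsto> x], \<lambda>_. b x) \<in> T" by (rule T_act) (auto split: if_splits)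
  then show "b x \<in> elems T" by (simp add: elems_def diag_rename)
next
  assume "b x \<in> elems T"
  then have "(diag V 0 0, \<lambda>_. b x) \<in> T" by (simp add: elems_def)
  then have "(diag V 0 0 \<cdot> [x \<mapsto> 0], b) \<in> T" by (rule T_act) (auto split: if_splits)
  then show "(diag V x x, b) \<in> T" by (simp add: diag_rename)
qed

lemma T_elems: "\<lbrakk>(u, b) \<in> T; x \<in> odom V u\<rbrakk> \<Longrightarrow> b x \<in> elems T"
  using T_up[of u b "diag V x x"] T_diag_same[of x b] T_carrier[of u b] diag_closed[of x x] A13[of u]
  by simp

lemma T_diag_eq:
  assumes "b x = b y" "b x \<in> elems T"
  shows "(diag V x y, b) \<in> T"
proof -
  have "(diag V x x \<cdot> [x \<mapsto> x, y \<mapsto> x], b) \<in> T"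
    using assms T_diag_same by (intro T_act[of _ b]) (auto split: if_splits)
  then show ?thesis using A10[of x y] by simp
qed

text \<open>Conjoining true equalities to \<open>w\<close> prepares for
  \<open>act_diag_cong\<close>, which can then exchange variables of equal value.\<close>

lemma T_meet_diags:
  assumes "finite E" "(w, b) \<in> T" "\<And>p q. (p, q) \<in> E \<Longrightarrow> (diag V p q, b) \<in> T"
  obtains w' where "(w', b) \<in> T" "w' \<sqsubseteq> w" "\<And>p q. (p, q) \<in> E \<Longrightarrow> w' \<sqsubseteq> diag V p q"
    "odom V w' = odom V w \<union> fst ` E \<union> snd ` E"
proof -
  have "\<exists>w'. (w', b) \<in> T \<and> w' \<sqsubseteq> w \<and> (\<forall>(p, q) \<in> E. w' \<sqsubseteq> diag V p q) \<and>
    odom V w' = odom V w \<union> fst ` E \<union> snd ` E"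
    using assms
  proof (induction E rule: finite_induct)
    case empty
    then show ?case using T_carrier by (intro exI[of _ w]) auto
  next
    case (insert e E)
    obtain p q where e: "e = (p, q)" by force
    obtain w' where w': "(w', b) \<in> T" "w' \<sqsubseteq> w" "\<And>p q. (p, q) \<in> E \<Longrightarrow> w' \<sqsubseteq> diag V p q"
      "odom V w' = odom V w \<union> fst ` E \<union> snd ` E"
      using insert.IH[OF insert.prems(1)] insert.prems(2) by (metis (no_types, lifting) case_prodD insertI2)
    have m: "(w' \<sqinter> diag V p q, b) \<in> T" using insert.prems e w' by (intro T_meet) auto
    note c = T_carrier[OF w'(1)] diag_closed[of p q] T_carrier[OF m]
    have le: "w' \<sqinter> diag V p q \<sqsubseteq> x" if "w' \<sqsubseteq> x" "x \<in> carrier V" for x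
      using le_trans[OF meet_le1[OF c(1,2)] that(1)] c that by blast
    have "odom V (w' \<sqinter> diag V p q) = odom V w' \<union> {p, q}"
      using odom_meet[OF c(1,2)] T_nonzero[OF m] by (simp add: odom_diag)
    moreover have "w' \<sqinter> diag V p q \<sqsubseteq> diag V p q" using c by (intro meet_le2) auto
    ultimately show ?case
      using m le[OF w'(2) T_carrier[OF insert.prems(1)]] le[OF w'(3)] w'(4) diag_closed
      unfolding e by (intro exI[of _ "w' \<sqinter> diag V p q"]) auto
  qed
  then show ?thesis using that by (metis (no_types, lifting) case_prodD)
qed

text \<open>An injective renaming loses nothing, since acting with it on the renamed formula
  recovers \<open>u\<close>. It serves to give two formulas disjoint variables.\<close>

lemma T_rename:
  assumes T: "(u, b) \<in> T" and inj: "inj_on r (odom V u)"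
    and c: "\<And>x. x \<in> odom V u \<Longrightarrow> c (r x) = b x"
  obtains w where "(w, c) \<in> T" "odom V w = r ` odom V u"
    "w \<cdot> (\<lambda>x. if x \<in> odom V u then Some (r x) else None) = u"
proof -
  let ?D = "odom V u"
  let ?f = "\<lambda>x. if x \<in> ?D then Some (r x) else None"
  let ?g = "\<lambda>y. if y \<in> r ` ?D then Some (inv_into ?D r y) else None"
  have fin: "finite ?D" by (rule T_finite[OF T])
  have g: "?g \<in> T_fp" and f: "?f \<in> T_fp" using fin by auto
  have "(u \<cdot> ?g, c) \<in> T"
    using inj c by (intro T_act[OF T g]) (auto split: if_splits)
  moreover have "odom V (u \<cdot> ?g) = r ` ?D"
    using A11[OF T_carrier[OF T] g T_nonzero[OF T]] inj by (auto simp: pmap_vimage_def)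
  moreover have "u \<cdot> ?g \<cdot> ?f = u"
  proof -
    have "?g \<circ>\<^sub>m ?f = pid ?D" using inj by (auto simp: map_comp_def pid_def)
    then show ?thesis using A7[OF T_carrier[OF T] g f] act_pid_eq[OF T_carrier[OF T] fin] by simp
  qed
  ultimately show ?thesis by (rule that)
qed

end

section \<open>Conservative extension by the witnesses of one formula\<close>

text \<open>
  The values \<open>h\<close> are the new witnesses of the existential statement \<open>v \<cdot> pid X\<close>, which \<open>T\<close> asserts of
  \<open>a\<close>. The extended theory consists of the consequences of \<open>w \<sqinter> v\<close>, for the formulas \<open>w\<close> of \<open>T\<close> whose
  variables have been renamed away from those of \<open>v\<close> outside \<open>X\<close>.
\<close>

locale orbital_witness = orbital_theory V T
  for V :: "('a, 'm) orbital_alg_scheme" (structure) and T :: "('a \<times> (var \<Rightarrow> 'k)) set" +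
  fixes v :: 'a and X :: "var set" and a h :: "var \<Rightarrow> 'k"
  assumes v_closed: "v \<in> carrier V"
    and X_sub: "X \<subseteq> odom V v"
    and ex_v: "(v \<cdot> pid X, a) \<in> T"
    and v_nonzero: "v \<noteq> \<zero>"
    and h_inj: "inj_on h (odom V v - X)"
    and h_fresh: "y \<in> odom V v - X \<Longrightarrow> h y \<notin> elems T"
begin

definition new :: "var set" where "new = odom V v - X"

definition val :: "(var \<Rightarrow> 'k) \<Rightarrow> var \<Rightarrow> 'k" where
  "val c y = (if y \<in> new then h y else c y)"

text \<open>As in forcing, \<open>w\<close> is a piece of \<open>T\<close>. Lying below
  \<open>v \<cdot> pid X\<close> makes \<open>w \<sqinter> v\<close> conservative over
  \<open>w\<close>, and avoiding \<open>new\<close> keeps its variables apart from those of the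
  witnesses.\<close>

definition cond :: "'a \<Rightarrow> (var \<Rightarrow> 'k) \<Rightarrow> bool" where
  "cond w c \<longleftrightarrow> (w, c) \<in> T \<and> w \<sqsubseteq> v \<cdot> pid X \<and> odom V w \<inter> new = {} \<and> (\<forall>x\<in>X. c x = a x)"

text \<open>\<open>f\<close> tells from which variable of \<open>w \<sqinter> v\<close> a variable
  of \<open>u\<close> is read. Distinct variables may carry the same value, so \<open>b\<close> does
  not determine \<open>f\<close>; this is the difficulty in \<open>ext_meet\<close>.\<close>

definition forces :: "'a \<Rightarrow> (var \<Rightarrow> 'k) \<Rightarrow> (var \<rightharpoonup> var) \<Rightarrow> 'a \<Rightarrow> (var \<Rightarrow> 'k) \<Rightarrow> bool" where
  "forces w c f u b \<longleftrightarrow> u \<in> carrier V \<and> f \<in> T_fp \<and> (w \<sqinter> v) \<cdot> f \<sqsubseteq> u \<and>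
     (\<forall>x\<in>odom V u. \<exists>y. f x = Some y \<and> b x = val c y)"

definition ext :: "('a \<times> (var \<Rightarrow> 'k)) set" where
  "ext = {(u, b). \<exists>w c f. cond w c \<and> forces w c f u b}"

lemma finite_v: "finite (odom V v)" using A12 v_closed v_nonzero .
lemma finite_X: "finite X" using finite_v X_sub by (blast intro: finite_subset)
lemma exv_closed: "v \<cdot> pid X \<in> carrier V" using T_carrier ex_v by blast
lemma odom_exv: "odom V (v \<cdot> pid X) = X"
  using odom_act_pid[OF v_closed v_nonzero finite_X] X_sub by auto
lemma odom_v: "odom V v = X \<union> new" "X \<inter> new = {}" using X_sub by (auto simp: new_def)

lemma cond_base: "cond (v \<cdot> pid X) a"
  using ex_v exv_closed odom_exv odom_v by (simp add: cond_def)

text \<open>As \<open>w\<close> shares only \<open>X\<close> with \<open>v\<close>, projecting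
  \<open>v\<close> to the domain of \<open>w\<close> gives \<open>v \<cdot> pid X\<close>, which
  \<open>w\<close> implies. Hence \<open>A3\<close> projects \<open>w \<sqinter> v\<close> back to
  \<open>w\<close>, and the meet cannot vanish.\<close>

lemma
  assumes "cond w c"
  shows cond_T: "(w, c) \<in> T" and cond_closed: "w \<in> carrier V" "w \<sqinter> v \<in> carrier V"
    and cond_X: "X \<subseteq> odom V w" and cond_finite: "finite (odom V w)"
    and cond_project: "(w \<sqinter> v) \<cdot> pid (odom V w) = w"
    and cond_nonzero: "w \<sqinter> v \<noteq> \<zero>"
    and cond_odom: "odom V (w \<sqinter> v) = odom V w \<union> new"
proof -
  show T: "(w, c) \<in> T" using assms by (simp add: cond_def)
  then show w: "w \<in> carrier V" by (rule T_carrier)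
  then show wv: "w \<sqinter> v \<in> carrier V" using v_closed by (rule meet_closed)
  show X: "X \<subseteq> odom V w" using odom_antimono[OF _ w exv_closed] assms odom_exv by (simp add: cond_def)
  show fin: "finite (odom V w)" by (rule T_finite[OF T])
  have "v \<cdot> pid (odom V w) = v \<cdot> pid X"
    using fin finite_X v_closed X assms odom_v by (intro act_cong) (auto simp: pid_def cond_def)
  then show p: "(w \<sqinter> v) \<cdot> pid (odom V w) = w"
    using A3[OF w v_closed fin] assms by (simp add: cond_def ole_def)
  show nz: "w \<sqinter> v \<noteq> \<zero>" using p A2[of "pid (odom V w)"] fin T_nonzero[OF T] by auto
  show "odom V (w \<sqinter> v) = odom V w \<union> new" using odom_meet[OF w v_closed nz] X odom_v by auto
qed

lemma forces_nonzero: "\<lbrakk>cond w c; forces w c f u b\<rbrakk> \<Longrightarrow> u \<noteq> \<zero>"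
  unfolding forces_def
  using nonzero_mono[of "(w \<sqinter> v) \<cdot> f" u] act_nonzero[of "w \<sqinter> v" f] act_closed[of "w \<sqinter> v" f]
    cond_closed[of w c] cond_nonzero[of w c] by simp

lemma forces_odom:
  assumes "cond w c" "forces w c f u b" "x \<in> odom V u" "f x = Some y"
  shows "y \<in> odom V w \<union> new" "b x = val c y"
proof -
  have f: "f \<in> T_fp" "u \<in> carrier V" "(w \<sqinter> v) \<cdot> f \<sqsubseteq> u" using assms by (auto simp: forces_def)
  have "x \<in> odom V ((w \<sqinter> v) \<cdot> f)"
    using odom_antimono[OF f(3) act_closed[OF cond_closed(2)[OF assms(1)] f(1)] f(2)] assms by blast
  then show "y \<in> odom V w \<union> new"
    using A11[OF cond_closed(2)[OF assms(1)] f(1) cond_nonzero[OF assms(1)]] cond_odom[OF assms(1)] assms(4)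
    by (auto simp: pmap_vimage_def)
  show "b x = val c y" using assms by (auto simp: forces_def)
qed

text \<open>New variables have fresh values and variables of \<open>w\<close> have elements as
  values, so a value reveals from which kind of variable it comes.\<close>

lemma val_new_iff:
  assumes "cond w c" "y \<in> odom V w \<union> new"
  shows "val c y \<in> elems T \<longleftrightarrow> y \<notin> new"
  using assms h_fresh T_elems[OF cond_T[OF assms(1)]] by (auto simp: val_def new_def)

lemma forces_weaken:
  assumes "cond w c" "cond w' c'" "w' \<sqsubseteq> w" "\<And>y. y \<in> odom V w \<Longrightarrow> c' y = c y" "forces w c f u b"
  shows "forces w' c' f u b"
proof -
  note cl = cond_closed[OF assms(1)] cond_closed[OF assms(2)]
  have f: "f \<in> T_fp" "u \<in> carrier V" "(w \<sqinter> v) \<cdot> f \<sqsubseteq> u" using assms by (auto simp: forces_def)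
  have "w' \<sqinter> v \<sqsubseteq> w \<sqinter> v" using meet_mono[OF assms(3) le_refl] cl v_closed by blast
  then have "(w' \<sqinter> v) \<cdot> f \<sqsubseteq> u"
    using le_trans[OF A5[OF cl(4,2) f(1)] f(3)] cl f act_closed by blast
  moreover have "\<exists>y. f x = Some y \<and> b x = val c' y" if x: "x \<in> odom V u" for x
  proof -
    obtain y where y: "f x = Some y" using x assms(5) by (auto simp: forces_def)
    then show ?thesis using forces_odom[OF assms(1,5) x y] assms(4) by (auto simp: val_def)
  qed
  ultimately show ?thesis using f by (simp add: forces_def)
qed

text \<open>Both conditions hold in \<open>T\<close>, so the meet of one with a renamed copy of the
  other does as well. This brings facts forced under the same \<open>b\<close> to a common
  condition.\<close>

lemma merge:
  assumes 1: "cond w1 c1" "forces w1 c1 f1 u1 b" and 2: "cond w2 c2" "forces w2 c2 f2 u2 b"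
  obtains w c g1 g2 where "cond w c" "forces w c g1 u1 b" "forces w c g2 u2 b"
proof -
  obtain m where m: "\<And>y. y \<in> odom V v \<union> odom V w1 \<Longrightarrow> y < m"
    using finite_nat_set_iff_bounded[of "odom V v \<union> odom V w1"] finite_v cond_finite[OF 1(1)] by auto
  \<comment> \<open>Rename \<open>w2\<close> apart from \<open>w1\<close>, except for the variables in \<open>X\<close>, where both agree with \<open>a\<close>.\<close>
  define r where "r y = (if y \<in> odom V v then y else y + m)" for y
  define c where "c y = (if y \<in> odom V w1 then c1 y else c2 (y - m))" for y
  let ?f = "\<lambda>x. if x \<in> odom V w2 then Some (r x) else None"
  \<comment> \<open>\<open>R\<close> extends the renaming of \<open>w2\<close> by the identity on
    the variables of \<open>v\<close>, so that it carries \<open>w \<sqinter> v\<close> below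
    \<open>w2 \<sqinter> v\<close>.\<close>
  define R where "R x = (if x \<in> odom V w2 \<union> odom V v then Some (r x) else None)" for x
  have d2: "odom V w2 \<inter> odom V v \<subseteq> X" using 2(1) odom_v by (auto simp: cond_def)
  have r_inj: "inj r"
    using m by (intro injI) (auto simp: r_def split: if_splits; fastforce)
  have r_new: "r y \<in> new \<longleftrightarrow> y \<in> new" for y
    using m[of "y + m"] odom_v by (auto simp: r_def)
  have c_r: "c (r x) = c2 x" if "x \<in> odom V w2" for x
  proof (cases "x \<in> odom V v")
    case True
    then have "x \<in> X" using that d2 by blast
    then show ?thesis using 1(1) 2(1) cond_X[OF 1(1)] True by (auto simp: c_def r_def cond_def)
  next
    case False
    then show ?thesis using m[of "x + m"] by (auto simp: c_def r_def)
  qed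
  obtain w3 where w3: "(w3, c) \<in> T" "odom V w3 = r ` odom V w2" "w3 \<cdot> ?f = w2"
    using T_rename[OF cond_T[OF 2(1)] inj_on_subset[OF r_inj], of c] c_r by auto
  define w where "w = w1 \<sqinter> w3"
  have w1T: "(w1, c) \<in> T" by (rule T_cong[OF cond_T[OF 1(1)]]) (simp add: c_def)
  have wT: "(w, c) \<in> T" unfolding w_def by (rule T_meet[OF w1T w3(1)])
  have cl: "w1 \<in> carrier V" "w2 \<in> carrier V" "w3 \<in> carrier V" "w \<in> carrier V"
    using T_carrier cond_closed 1 2 w3 wT by blast+
  have le: "w \<sqsubseteq> w1" "w \<sqsubseteq> w3" unfolding w_def using cl meet_le1 meet_le2 by auto
  have ow: "odom V w = odom V w1 \<union> r ` odom V w2"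
    using odom_meet[OF cl(1,3)] T_nonzero[OF wT] w3(2) by (simp add: w_def)
  have cond: "cond w c"
    unfolding cond_def
  proof (intro conjI)
    show "w \<sqsubseteq> v \<cdot> pid X"
      using le_trans[OF le(1)] 1(1) cl exv_closed by (auto simp: cond_def)
    show "odom V w \<inter> new = {}"
      using 1(1) 2(1) r_new by (auto simp: ow cond_def)
    show "\<forall>x\<in>X. c x = a x" using 1(1) cond_X[OF 1(1)] by (auto simp: cond_def c_def)
  qed (rule wT)
  have "forces w c f1 u1 b"
    by (rule forces_weaken[OF 1(1) cond le(1) _ 1(2)]) (simp add: c_def)
  moreover have "forces w c (R \<circ>\<^sub>m f2) u2 b"
  proof -
    note wv = cond_closed(2)[OF cond] and w2v = cond_closed(2)[OF 2(1)]
    have f2: "f2 \<in> T_fp" "u2 \<in> carrier V" "(w2 \<sqinter> v) \<cdot> f2 \<sqsubseteq> u2" using 2 by (auto simp: forces_def)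
    have finR: "finite (odom V w2 \<union> odom V v)" using finite_v cond_finite[OF 2(1)] by blast
    then have R: "R \<in> T_fp" unfolding R_def by (rule T_fp_total)
    have fT: "?f \<in> T_fp" using cond_finite[OF 2(1)] by (rule T_fp_total)
    have "(w \<sqinter> v) \<cdot> R \<sqsubseteq> w2"
    proof (rule act_le_weaken[OF wv R cl(2), where Y = "odom V w2"])
      have "R |` odom V w2 = ?f" by (auto simp: R_def restrict_map_def)
      moreover have "w \<sqinter> v \<sqsubseteq> w3"
        using le_trans[OF meet_le1[OF cl(4) v_closed] le(2)] cl wv by blast
      ultimately show "(w \<sqinter> v) \<cdot> (R |` odom V w2) \<sqsubseteq> w2"
        using A5[OF wv cl(3) fT] w3(3) by simp
    qed
    moreover have "(w \<sqinter> v) \<cdot> R \<sqsubseteq> v"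
    proof (rule act_le_weaken[OF wv R v_closed, where Y = "odom V v"])
      have "R |` odom V v = pid (odom V v)" by (auto simp: R_def r_def restrict_map_def pid_def)
      then show "(w \<sqinter> v) \<cdot> (R |` odom V v) \<sqsubseteq> v"
        using A5[OF wv v_closed T_fp_pid[OF finite_v] meet_le2[OF cl(4) v_closed]]
          act_pid_eq[OF v_closed finite_v] by simp
    qed
    ultimately have "(w \<sqinter> v) \<cdot> R \<sqsubseteq> w2 \<sqinter> v"
      using meet_glb act_closed[OF wv R] cl(2) v_closed by blast
    then have "(w \<sqinter> v) \<cdot> (R \<circ>\<^sub>m f2) \<sqsubseteq> (w2 \<sqinter> v) \<cdot> f2"
      by (rule act_le_act_mono[OF _ wv w2v f2(1) R])
    then have "(w \<sqinter> v) \<cdot> (R \<circ>\<^sub>m f2) \<sqsubseteq> u2"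
      by (rule le_trans[OF _ f2(3)]) (use act_closed wv w2v f2 in auto)
    moreover have "\<exists>y. (R \<circ>\<^sub>m f2) x = Some y \<and> b x = val c y" if x: "x \<in> odom V u2" for x
    proof -
      obtain y where y: "f2 x = Some y" using 2(2) x by (auto simp: forces_def)
      note fo = forces_odom[OF 2 x y]
      have "(R \<circ>\<^sub>m f2) x = Some (r y)" using y fo odom_v by (auto simp: R_def)
      moreover have "val c (r y) = val c2 y"
        using fo(1) r_new[of y] c_r[of y] by (auto simp: val_def) (auto simp: r_def odom_v)
      ultimately show ?thesis using fo by simp
    qed
    ultimately show ?thesis using f2 by (auto simp: forces_def)
  qed
  ultimately show ?thesis by (rule that[OF cond])
qed

lemma ext_meet:
  assumes "(u1, b) \<in> ext" "(u2, b) \<in> ext"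
  shows "(u1 \<sqinter> u2, b) \<in> ext"
proof -
  obtain w c g1 g2 where w: "cond w c" and 1: "forces w c g1 u1 b" and 2: "forces w c g2 u2 b"
    using assms merge unfolding ext_def by blast
  have g: "g1 \<in> T_fp" "g2 \<in> T_fp" and u: "u1 \<in> carrier V" "u2 \<in> carrier V"
    using 1 2 by (auto simp: forces_def)
  note nz = forces_nonzero[OF w 1] forces_nonzero[OF w 2]
  let ?D = "odom V u1 \<inter> odom V u2"
  \<comment> \<open>\<open>g1\<close> and \<open>g2\<close> may send a shared variable to distinct variables, but these have the same value
    under \<open>c\<close>, so the corresponding diagonals may be added to \<open>w\<close>.\<close>
  define E where "E = {(p, q). p \<noteq> q \<and> (\<exists>x\<in>?D. g1 x = Some p \<and> g2 x = Some q)}"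
  have E: "p \<in> odom V w" "q \<in> odom V w" "(diag V p q, c) \<in> T" if pq: "(p, q) \<in> E" for p q
  proof -
    obtain x where x: "x \<in> ?D" "g1 x = Some p" "g2 x = Some q" "p \<noteq> q"
      using pq unfolding E_def by blast
    have xu: "x \<in> odom V u1" "x \<in> odom V u2" using x(1) by auto
    note p = forces_odom[OF w 1 xu(1) x(2)] and q = forces_odom[OF w 2 xu(2) x(3)]
    have eq: "val c p = val c q" using p(2) q(2) by simp
    have iff: "p \<in> new \<longleftrightarrow> q \<in> new" using eq val_new_iff[OF w p(1)] val_new_iff[OF w q(1)] by simp
    \<comment> \<open>Since \<open>h\<close> is injective, distinct new variables never share a
      value. So \<open>p\<close> and \<open>q\<close> are variables of \<open>w\<close>, and
      \<open>T\<close> itself asserts that their values are equal.\<close>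
    have "p \<notin> new" 
    proof
      assume "p \<in> new"
      then show False using iff eq h_inj x(4) by (simp add: val_def new_def inj_on_def)
    qed
    then show "p \<in> odom V w" "q \<in> odom V w" using iff p(1) q(1) by auto
    show "(diag V p q, c) \<in> T"
      using eq iff \<open>p \<notin> new\<close> T_elems[OF cond_T[OF w] \<open>p \<in> odom V w\<close>]
      by (intro T_diag_eq) (simp_all add: val_def)
  qed
  have "E \<subseteq> odom V w \<times> odom V w" using E by auto
  then have finE: "finite E" using cond_finite[OF w] finite_subset by blast
  obtain w' where w': "(w', c) \<in> T" "w' \<sqsubseteq> w" "\<And>p q. (p, q) \<in> E \<Longrightarrow> w' \<sqsubseteq> diag V p q"
    "odom V w' = odom V w \<union> fst ` E \<union> snd ` E"
    using T_meet_diags[OF finE cond_T[OF w] E(3)] by blast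
  have ow': "odom V w' = odom V w" using w'(4) E by force
  note cl = cond_closed(1)[OF w] T_carrier[OF w'(1)]
  have cw': "cond w' c"
    using w w' ow' le_trans[OF w'(2) _ cl(2,1) exv_closed] by (auto simp: cond_def)
  note f1 = forces_weaken[OF w cw' w'(2) refl 1] and f2 = forces_weaken[OF w cw' w'(2) refl 2]
  define z where "z = w' \<sqinter> v"
  have z: "z \<in> carrier V" "z \<noteq> \<zero>" "odom V z = odom V w \<union> new"
    using cond_closed[OF cw'] cond_nonzero[OF cw'] cond_odom[OF cw'] ow' by (auto simp: z_def)
  have zE: "z \<sqsubseteq> diag V p q" if "(p, q) \<in> E" for p q
    using le_trans[OF meet_le1[OF cl(2) v_closed] w'(3)[OF that]] z cl diag_closed by (simp add: z_def)
  \<comment> \<open>On shared variables \<open>f\<close> follows \<open>g2\<close>. On the domain of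
    \<open>u1\<close> it then differs from \<open>g1\<close> only along \<open>E\<close>, and
    \<open>z\<close> lies below those diagonals.\<close>
  define f where "f x = (if x \<in> odom V u2 then g2 x else g1 x)" for x
  have "dom f \<subseteq> dom g1 \<union> dom g2" by (auto simp: f_def dom_def split: if_splits)
  then have fT: "f \<in> T_fp" using g finite_subset by (auto simp: T_fp_def)
  have "z \<cdot> f \<sqsubseteq> u2"
  proof (rule act_le_weaken[OF z(1) fT u(2), where Y = "odom V u2"])
    have "f |` odom V u2 = g2 |` odom V u2" by (auto simp: f_def restrict_map_def)
    then show "z \<cdot> (f |` odom V u2) \<sqsubseteq> u2"
      using act_restrict_odom_le[OF _ z(1) u(2) nz(2) g(2)] f2 by (auto simp: forces_def z_def)
  qed
  moreover have "z \<cdot> f \<sqsubseteq> u1"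
  proof (rule act_le_weaken[OF z(1) fT u(1), where Y = "odom V u1"])
    have "z \<cdot> (f |` odom V u1) = z \<cdot> (g1 |` odom V u1)"
    proof (rule act_diag_cong)
      show "dom (f |` odom V u1) = dom (g1 |` odom V u1)"
      proof -
        have "odom V u1 \<subseteq> dom g1" "odom V u2 \<subseteq> dom g2" using 1 2 by (auto simp: forces_def)
        then have "x \<in> dom f" if "x \<in> odom V u1" for x using that by (auto simp: f_def dom_def)
        then show ?thesis using \<open>odom V u1 \<subseteq> dom g1\<close> by auto
      qed
      fix x q p assume a: "(f |` odom V u1) x = Some q" "(g1 |` odom V u1) x = Some p"
      have x: "x \<in> odom V u1" using a by (auto simp: restrict_map_def split: if_splits)
      have g1x: "g1 x = Some p" and fx: "f x = Some q" using a x by auto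
      show "z \<sqsubseteq> diag V q p"
      proof (cases "p = q")
        case True
        then have "p \<in> odom V z" using forces_odom[OF w 1 x g1x] z(3) by simp
        then show ?thesis using True A13[OF z(1)] by simp
      next
        case False
        then have "(p, q) \<in> E" using x g1x fx by (auto simp: E_def f_def split: if_splits)
        then show ?thesis using zE diag_sym by metis
      qed
    qed (use z fT g in auto)
    then show "z \<cdot> (f |` odom V u1) \<sqsubseteq> u1"
      using act_restrict_odom_le[OF _ z(1) u(1) nz(1) g(1)] f1 by (auto simp: forces_def z_def)
  qed
  ultimately have le: "z \<cdot> f \<sqsubseteq> u1 \<sqinter> u2" using meet_glb u act_closed[OF z(1) fT] by blast
  then have "u1 \<sqinter> u2 \<noteq> \<zero>"
    using nonzero_mono act_nonzero[OF z(1) fT z(2)] act_closed[OF z(1) fT] meet_closed u by blast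
  then have "odom V (u1 \<sqinter> u2) = odom V u1 \<union> odom V u2" using odom_meet u by blast
  then have "forces w' c f (u1 \<sqinter> u2) b"
    using le fT meet_closed[OF u] 1 2 by (auto simp: forces_def z_def f_def)
  then show ?thesis using cw' by (auto simp: ext_def)
qed

text \<open>Shifting the variables of \<open>u\<close> past those of \<open>v\<close> and conjoining
  \<open>v \<cdot> pid X\<close> gives a condition, and shifting back forces
  \<open>u\<close>.\<close>

lemma ext_extends: "T \<subseteq> ext"
proof clarify
  fix u b assume T: "(u, b) \<in> T"
  note u = T_carrier[OF T] T_nonzero[OF T]
  obtain m where m: "\<And>y. y \<in> odom V v \<Longrightarrow> y < m"
    using finite_nat_set_iff_bounded[of "odom V v"] finite_v by auto
  define c where "c y = (if y \<in> X then a y else b (y - m))" for y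
  let ?f = "\<lambda>x. if x \<in> odom V u then Some (x + m) else None"
  have nX: "x + m \<notin> odom V v" for x using m[of "x + m"] by auto
  then have c: "c (x + m) = b x" for x using X_sub by (auto simp: c_def)
  obtain w0 where w0: "(w0, c) \<in> T" "odom V w0 = (\<lambda>x. x + m) ` odom V u" "w0 \<cdot> ?f = u"
    using T_rename[OF T, of "\<lambda>x. x + m" c] c by (auto simp: inj_on_def)
  define w where "w = w0 \<sqinter> v \<cdot> pid X"
  have wT: "(w, c) \<in> T"
    unfolding w_def by (rule T_meet[OF w0(1) T_cong[OF ex_v]]) (simp add: odom_exv c_def)
  note cl = T_carrier[OF w0(1)] exv_closed T_carrier[OF wT]
  have "odom V w = odom V w0 \<union> X" using odom_meet[OF cl(1,2)] T_nonzero[OF wT] odom_exv by (simp add: w_def)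
  then have cond: "cond w c"
    unfolding cond_def using wT meet_le2[OF cl(1,2)] w0(2) nX odom_v by (auto simp: w_def c_def)
  note wv = cond_closed(2)[OF cond]
  have fT: "?f \<in> T_fp" using T_finite[OF T] by (rule T_fp_total)
  have "w \<sqinter> v \<sqsubseteq> w0"
    using le_trans[OF meet_le1[OF cl(3) v_closed]] meet_le1[OF cl(1,2)] cl wv by (simp add: w_def)
  then have "(w \<sqinter> v) \<cdot> ?f \<sqsubseteq> u" using A5[OF wv cl(1) fT] w0(3) by simp
  then have "forces w c ?f u b"
    using u fT c nX odom_v by (auto simp: forces_def val_def)
  then show "(u, b) \<in> ext" using cond by (auto simp: ext_def)
qed

text \<open>If all values are old, \<open>f\<close> reads only variables of \<open>w\<close>. Then
  \<open>v\<close> can be projected away by \<open>cond_project\<close>, and \<open>u\<close>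
  follows from \<open>w\<close> alone.\<close>

lemma ext_conservative:
  assumes "(u, b) \<in> ext" "\<And>x. x \<in> odom V u \<Longrightarrow> b x \<in> elems T"
  shows "(u, b) \<in> T"
proof -
  obtain w c f where w: "cond w c" and f: "forces w c f u b" using assms(1) by (auto simp: ext_def)
  have u: "u \<in> carrier V" "u \<noteq> \<zero>" and fT: "f \<in> T_fp" and le: "(w \<sqinter> v) \<cdot> f \<sqsubseteq> u"
    using f forces_nonzero[OF w f] by (auto simp: forces_def)
  note cl = cond_closed[OF w]
  have y: "y \<in> odom V w \<and> b x = c y" if "x \<in> odom V u" "f x = Some y" for x y
    using forces_odom[OF w f that] val_new_iff[OF w, of y] assms(2)[OF that(1)] by (auto simp: val_def)
  let ?g = "f |` odom V u"
  have "pid (odom V w) \<circ>\<^sub>m ?g = ?g"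
  proof
    fix x show "(pid (odom V w) \<circ>\<^sub>m ?g) x = ?g x"
      using y[of x] by (cases "?g x") (auto simp: map_comp_def pid_def restrict_map_def split: if_splits)
  qed
  then have "w \<cdot> ?g = (w \<sqinter> v) \<cdot> ?g"
    using A7[OF cl(2), of "pid (odom V w)" ?g] cond_project[OF w] cond_finite[OF w] fT by simp
  then have le': "w \<cdot> ?g \<sqsubseteq> u" using act_restrict_odom_le[OF le cl(2) u fT] by simp
  have "(w \<cdot> ?g, b) \<in> T"
    using y by (intro T_act[OF cond_T[OF w] T_fp_restrict[OF fT]]) (auto simp: restrict_map_def split: if_splits)
  then show ?thesis using T_up le' u by blast
qed

lemma ext_theory: "orbital_theory V ext"
proof unfold_locales
  show "u \<in> carrier V" if "(u, b) \<in> ext" for u b using that by (auto simp: ext_def forces_def)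
  show "u \<noteq> \<zero>" if "(u, b) \<in> ext" for u b using that forces_nonzero by (fastforce simp: ext_def)
  show "(\<one>, b) \<in> ext" for b using T_one ext_extends by blast
  show "(u1 \<sqinter> u2, b) \<in> ext" if "(u1, b) \<in> ext" "(u2, b) \<in> ext" for u1 u2 b by (rule ext_meet[OF that])
  show "(u', b) \<in> ext" if ub: "(u, b) \<in> ext" and le: "u \<sqsubseteq> u'" and u': "u' \<in> carrier V" for u b u'
  proof -
    obtain w c f where w: "cond w c" and f: "forces w c f u b" using ub by (auto simp: ext_def)
    then have u: "u \<in> carrier V" "f \<in> T_fp" "(w \<sqinter> v) \<cdot> f \<sqsubseteq> u" by (auto simp: forces_def)
    have "(w \<sqinter> v) \<cdot> f \<sqsubseteq> u'" using le_trans[OF u(3) le] act_closed cond_closed[OF w] u u' by blast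
    then have "forces w c f u' b" using f odom_antimono[OF le u(1) u'] u' by (auto simp: forces_def)
    then show ?thesis using w by (auto simp: ext_def)
  qed
  show "(u \<cdot> g, b') \<in> ext"
    if ub: "(u, b) \<in> ext" and g: "g \<in> T_fp"
      and b': "\<And>x y. g x = Some y \<Longrightarrow> y \<in> odom V u \<Longrightarrow> b' x = b y" for u b g b'
  proof -
    obtain w c f where w: "cond w c" and f: "forces w c f u b" using ub by (auto simp: ext_def)
    then have u: "u \<in> carrier V" "f \<in> T_fp" "(w \<sqinter> v) \<cdot> f \<sqsubseteq> u" by (auto simp: forces_def)
    have "(w \<sqinter> v) \<cdot> (f \<circ>\<^sub>m g) \<sqsubseteq> u \<cdot> g" using act_le_act_mono[OF u(3)] cond_closed[OF w] u g by blast
    moreover have "\<exists>y. (f \<circ>\<^sub>m g) x = Some y \<and> b' x = val c y" if x: "x \<in> odom V (u \<cdot> g)" for x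
    proof -
      obtain x' where x': "g x = Some x'" "x' \<in> odom V u"
        using x A11[OF u(1) g forces_nonzero[OF w f]]
        by (auto simp: pmap_vimage_def)
      then obtain y where "f x' = Some y" "b x' = val c y" using f by (auto simp: forces_def)
      then show ?thesis using x' b'[of x x'] by auto
    qed
    ultimately have "forces w c (f \<circ>\<^sub>m g) (u \<cdot> g) b'"
      using act_closed[OF u(1) g] g by (simp add: forces_def)
    then show ?thesis using w by (auto simp: ext_def)
  qed
qed

lemma ext_witness: "(v, val a) \<in> ext"
proof -
  have "v \<cdot> pid X \<sqinter> v = v"
    using A4[OF v_closed finite_X] meet_comm[OF v_closed exv_closed] by (simp add: ole_def)
  then have "forces (v \<cdot> pid X) a (pid (odom V v)) v (val a)"
    using v_closed finite_v act_pid_eq[OF v_closed finite_v] by (simp add: forces_def) (simp add: pid_def)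
  then show ?thesis using cond_base by (auto simp: ext_def)
qed

text \<open>Witnesses for one formula bring in no constants of any other, which keeps the invariant
  \<open>henkin_theory\<close> under control.\<close>

lemma elems_ext: "elems ext \<subseteq> elems T \<union> h ` new"
proof
  fix k assume "k \<in> elems ext"
  then have "(diag V 0 0, \<lambda>_. k) \<in> ext" by (simp add: elems_def)
  then obtain w c f where w: "cond w c" and f: "forces w c f (diag V 0 0) (\<lambda>_. k)" by (auto simp: ext_def)
  then obtain y where y: "f 0 = Some y" using odom_diag_same[of 0] by (auto simp: forces_def)
  have "0 \<in> odom V (diag V 0 0)" by (simp add: odom_diag_same)
  note fo = forces_odom[OF w f this y]
  show "k \<in> elems T \<union> h ` new"
    using fo val_new_iff[OF w fo(1)] by (cases "y \<in> new") (auto simp: val_def)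
qed

text \<open>For \<open>X = {}\<close> the condition \<open>w\<close> shares no variable with
  \<open>v\<close>, so it projects away to \<open>\<one>\<close>. As \<open>h\<close> is injective
  with fresh values, \<open>f\<close> must be the identity on the domain of \<open>u\<close>, and
  \<open>u\<close> follows from \<open>v\<close> alone.\<close>

lemma ext_generic:
  assumes "X = {}" "(u, h) \<in> ext" "odom V u \<subseteq> odom V v"
  shows "v \<sqsubseteq> u"
proof -
  obtain w c f where w: "cond w c" and f: "forces w c f u h" using assms(2) by (auto simp: ext_def)
  have u: "u \<in> carrier V" "f \<in> T_fp" "(w \<sqinter> v) \<cdot> f \<sqsubseteq> u" "u \<noteq> \<zero>"
    using f forces_nonzero[OF w f] by (auto simp: forces_def)
  note cl = cond_closed[OF w]
  have "f |` odom V u = pid (odom V u)"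
  proof
    fix x show "(f |` odom V u) x = pid (odom V u) x"
    proof (cases "x \<in> odom V u")
      case True
      then obtain y where y: "f x = Some y" using f by (auto simp: forces_def)
      note fo = forces_odom[OF w f True y]
      have "x \<in> new" using True assms(1,3) unfolding new_def by blast
      moreover have "y \<in> new" using val_new_iff[OF w fo(1)] fo(2) h_fresh[of x] \<open>x \<in> new\<close> by (auto simp: new_def)
      ultimately have "x = y" using fo(2) h_inj by (auto simp: val_def new_def inj_on_def)
      then show ?thesis using y True by (simp add: pid_def)
    qed (simp add: pid_def)
  qed
  then have 1: "(w \<sqinter> v) \<cdot> pid (odom V u) \<sqsubseteq> u"
    using act_restrict_odom_le[OF u(3) cl(2) u(1,4,2)] by simp
  have "v \<sqinter> w = w \<sqinter> v" by (rule meet_comm[OF v_closed cl(1)])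
  moreover have "w \<cdot> pid (odom V v) = w \<cdot> pid {}"
  proof (rule act_cong)
    have "odom V w \<inter> odom V v = {}" using w odom_v(1) assms(1) unfolding cond_def by simp
    then show "pid (odom V v) x = Some y \<longleftrightarrow> pid {} x = Some y" if "y \<in> odom V w" for x y
      using that by (auto simp: pid_def)
  qed (use cl finite_v in auto)
  ultimately have "(w \<sqinter> v) \<cdot> pid (odom V v) = v"
    using A3[OF v_closed cl(1) finite_v] A1[OF cl(1)] T_nonzero[OF cond_T[OF w]]
      one_greatest[OF v_closed] by (simp add: ole_def)
  moreover have "pid (odom V v) \<circ>\<^sub>m pid (odom V u) = pid (odom V u)"
    using assms(3) by (auto simp: pid_def map_comp_def fun_eq_iff)
  ultimately have "v \<cdot> pid (odom V u) = (w \<sqinter> v) \<cdot> pid (odom V u)"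
    using A7[OF cl(2), of "pid (odom V v)" "pid (odom V u)"] finite_v A12[OF u(1,4)] by simp
  then have "v \<cdot> pid (odom V u) \<sqsubseteq> u" using 1 by simp
  moreover have "v \<sqsubseteq> v \<cdot> pid (odom V u)" using A4 v_closed A12[OF u(1,4)] by blast
  ultimately show ?thesis using le_trans v_closed u(1) act_closed A12[OF u(1,4)] T_fp_pid by meson
qed

end

section \<open>Saturated theories\<close>

text \<open>\<open>saturated\<close> makes tables commute with projections. \<open>generic\<close>
  makes the tables of nonzero elements nonempty and tells distinct elements apart.\<close>

locale orbital_saturated = orbital_theory V T
  for V :: "('a, 'm) orbital_alg_scheme" (structure) and T :: "('a \<times> (var \<Rightarrow> 'k)) set" +
  assumes saturated: "\<lbrakk>v \<in> carrier V; v \<noteq> \<zero>; X \<subseteq> odom V v; (v \<cdot> pid X, a) \<in> T\<rbrakk>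
      \<Longrightarrow> \<exists>b. (v, b) \<in> T \<and> (\<forall>x\<in>X. b x = a x)"
    and generic: "\<lbrakk>v \<in> carrier V; v \<noteq> \<zero>\<rbrakk>
      \<Longrightarrow> \<exists>b. (v, b) \<in> T \<and> (\<forall>u. (u, b) \<in> T \<longrightarrow> odom V u \<subseteq> odom V v \<longrightarrow> v \<sqsubseteq> u)"

section \<open>Henkin constants and maximal theories\<close>

locale orbital_henkin = orbital_semilattice V
  for V :: "('a, 'm) orbital_alg_scheme" (structure) +
  fixes H :: "'a \<Rightarrow> (var \<rightharpoonup> 'k) \<Rightarrow> var \<Rightarrow> 'k"
  assumes H_inj: "\<lbrakk>finite (dom a); finite (dom a'); H v a y = H v' a' y'\<rbrakk> \<Longrightarrow> v = v' \<and> a = a' \<and> y = y'"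
begin

text \<open>A task is a formula \<open>v\<close> with parameter values \<open>a\<close>. The
  constants \<open>H v a\<close> are reserved for it, and by \<open>H_inj\<close> no constant
  belongs to two tasks with finitely many parameters.\<close>

definition witness :: "'a \<Rightarrow> (var \<rightharpoonup> 'k) \<Rightarrow> var \<Rightarrow> 'k" where
  "witness v a x = (case a x of Some k \<Rightarrow> k | None \<Rightarrow> H v a x)"

text \<open>The second conjunct is what makes the representation injective: the witness of a nonzero
  \<open>v\<close> satisfies nothing but the consequences of \<open>v\<close>.\<close>

definition witnessed :: "'a \<Rightarrow> (var \<rightharpoonup> 'k) \<Rightarrow> ('a \<times> (var \<Rightarrow> 'k)) set \<Rightarrow> bool" where
  "witnessed v a T \<longleftrightarrow> (v, witness v a) \<in> T \<and>
     (a = Map.empty \<longrightarrow> (\<forall>u. (u, H v a) \<in> T \<longrightarrow> odom V u \<subseteq> odom V v \<longrightarrow> v \<sqsubseteq> u))"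

text \<open>A constant may occur only once its task is fulfilled. So an unfulfilled task has all its
  constants fresh, as \<open>orbital_witness\<close> requires.\<close>

definition henkin_theory :: "('a \<times> (var \<Rightarrow> 'k)) set \<Rightarrow> bool" where
  "henkin_theory T \<longleftrightarrow> orbital_theory V T \<and>
     (\<forall>v a y. finite (dom a) \<longrightarrow> H v a y \<in> elems T \<longrightarrow> witnessed v a T)"

definition conservative :: "('a \<times> (var \<Rightarrow> 'k)) set \<Rightarrow> ('a \<times> (var \<Rightarrow> 'k)) set \<Rightarrow> bool" where
  "conservative T T' \<longleftrightarrow> T \<subseteq> T' \<and>
     (\<forall>u b. (u, b) \<in> T' \<longrightarrow> (\<forall>x\<in>odom V u. b x \<in> elems T) \<longrightarrow> (u, b) \<in> T)"

lemma elems_mono: "T \<subseteq> T' \<Longrightarrow> elems T \<subseteq> elems T'"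
  by (auto simp: elems_def)

lemma conservative_trans: "\<lbrakk>conservative T T'; conservative T' T''\<rbrakk> \<Longrightarrow> conservative T T''"
  using elems_mono unfolding conservative_def by (meson subset_iff)

text \<open>The generic clause bounds what is true of the witness, so a mere superset of
  \<open>T\<close> could violate it. A conservative extension says nothing new about old elements,
  which is why Zorn's lemma is applied to that order.\<close>

lemma witnessed_conservative:
  assumes "orbital_theory V T" "conservative T T'" "witnessed v a T"
  shows "witnessed v a T'"
proof -
  interpret orbital_theory V T by fact
  have "v \<sqsubseteq> u" if a: "a = Map.empty" and u: "(u, H v a) \<in> T'" "odom V u \<subseteq> odom V v" for u
  proof -
    have "(v, H v a) \<in> T" using assms(3) a by (simp add: witnessed_def witness_def[abs_def])
    then have "H v a x \<in> elems T" if "x \<in> odom V u" for x using T_elems u(2) that by blast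
    then have "(u, H v a) \<in> T" using u(1) assms(2) by (auto simp: conservative_def)
    then show ?thesis using assms(3) a u(2) by (auto simp: witnessed_def)
  qed
  then show ?thesis using assms by (auto simp: witnessed_def conservative_def)
qed

lemma henkin_trivial: "henkin_theory ({\<one>} \<times> UNIV)"
proof -
  let ?T = "{\<one>} \<times> (UNIV :: (var \<Rightarrow> 'k) set)"
  \<comment> \<open>Hence this theory has no elements, and the condition on constants holds
    vacuously.\<close>
  have nd: "diag V 0 0 \<noteq> \<one>" using odom_diag_same[of 0] odom_one by force
  have "orbital_theory V (?T)"
  proof unfold_locales
    show "(v, b) \<in> ?T" if "(u, b) \<in> ?T" "u \<sqsubseteq> v" "v \<in> carrier V"
      for u v and b :: "var \<Rightarrow> 'k"
      using le_antisym[OF _ one_greatest] that one_closed by auto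
    show "(u \<sqinter> v, b) \<in> ?T" if "(u, b) \<in> ?T" "(v, b) \<in> ?T"
      for u v and b :: "var \<Rightarrow> 'k"
      using that one_closed meet_idem by auto
    show "(u \<cdot> f, b') \<in> ?T" if "(u, b) \<in> ?T" "f \<in> T_fp"
      for u f and b b' :: "var \<Rightarrow> 'k"
    proof -
      have "\<one> \<cdot> f = \<one>"
      proof (rule odom_empty)
        show "\<one> \<cdot> f \<in> carrier V" "\<one> \<cdot> f \<noteq> \<zero>"
          using act_closed act_nonzero one_closed one_nonzero that by auto
        show "odom V (\<one> \<cdot> f) = {}"
          using A11[OF one_closed that(2) one_nonzero] by (auto simp: pmap_vimage_def)
      qed
      then show ?thesis using that by auto
    qed
  qed (use one_closed one_nonzero in auto)
  then show ?thesis using nd by (auto simp: henkin_theory_def elems_def)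
qed

text \<open>A constant of the union occurs in some member of the chain. Its task is fulfilled there,
  and this persists because the member is conservative in the union.\<close>

lemma henkin_Union:
  assumes "C \<noteq> {}" and h: "\<And>T. T \<in> C \<Longrightarrow> henkin_theory T"
    and chain: "\<And>T T'. T \<in> C \<Longrightarrow> T' \<in> C \<Longrightarrow> conservative T T' \<or> conservative T' T"
  shows "henkin_theory (\<Union>C)" and "T \<in> C \<Longrightarrow> conservative T (\<Union>C)"
proof -
  have th: "orbital_theory V T" if "T \<in> C" for T using h that by (simp add: henkin_theory_def)
  have cons: "conservative T (\<Union>C)" if "T \<in> C" for T
    unfolding conservative_def
  proof (intro conjI allI impI)
    fix u b assume "(u, b) \<in> \<Union>C" and b: "\<forall>x\<in>odom V u. b x \<in> elems T"
    then obtain T' where "T' \<in> C" "(u, b) \<in> T'" by blast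
    then show "(u, b) \<in> T" using chain[OF that, of T'] b by (auto simp: conservative_def)
  qed (use that in blast)
  then show "T \<in> C \<Longrightarrow> conservative T (\<Union>C)" .
  have "orbital_theory V (\<Union>C)"
  proof unfold_locales
    show "u \<in> carrier V" if "(u, b) \<in> \<Union>C" for u b
      using that orbital_theory.T_carrier[OF th] by blast
    show "u \<noteq> \<zero>" if "(u, b) \<in> \<Union>C" for u b
      using that orbital_theory.T_nonzero[OF th] by blast
    show "(\<one>, b) \<in> \<Union>C" for b
      using assms(1) orbital_theory.T_one[OF th] by blast
    show "(v, b) \<in> \<Union>C" if "(u, b) \<in> \<Union>C" "u \<sqsubseteq> v" "v \<in> carrier V" for u v b
      using that orbital_theory.T_up[OF th] by blast
    show "(u \<cdot> f, b') \<in> \<Union>C"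
      if ub: "(u, b) \<in> \<Union>C" and f: "f \<in> T_fp"
        and b': "\<And>x y. f x = Some y \<Longrightarrow> y \<in> odom V u \<Longrightarrow> b' x = b y" for u b f b'
    proof -
      obtain T where "T \<in> C" "(u, b) \<in> T" using ub by blast
      then have "(u \<cdot> f, b') \<in> T" using orbital_theory.T_act[OF th _ f, of T u b b'] b' by blast
      then show ?thesis using \<open>T \<in> C\<close> by blast
    qed
    show "(u \<sqinter> v, b) \<in> \<Union>C" if uv: "(u, b) \<in> \<Union>C" "(v, b) \<in> \<Union>C" for u v b
    proof -
      obtain T where "T \<in> C" "(u, b) \<in> T" "(v, b) \<in> T"
        
      proof -
        obtain T1 T2 where "T1 \<in> C" "(u, b) \<in> T1" "T2 \<in> C" "(v, b) \<in> T2" using uv by blast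
        then show ?thesis using chain[of T1 T2] that by (auto simp: conservative_def)
      qed
      then show ?thesis using orbital_theory.T_meet[OF th] by blast
    qed
  qed
  moreover have "witnessed v a (\<Union>C)" if a: "finite (dom a)" and el: "H v a y \<in> elems (\<Union>C)" for v a y
  proof -
    obtain T where T: "T \<in> C" "H v a y \<in> elems T" using el by (auto simp: elems_def)
    then have "witnessed v a T" using h a unfolding henkin_theory_def by blast
    then show ?thesis using witnessed_conservative[OF th[OF T(1)] cons[OF T(1)]] by blast
  qed
  ultimately show "henkin_theory (\<Union>C)" by (simp add: henkin_theory_def)
qed

lemma henkin_extend:
  assumes T: "henkin_theory T" and ex: "(v \<cdot> pid X, a) \<in> T"
    and v: "v \<in> carrier V" "v \<noteq> \<zero>" and X: "X \<subset> odom V v"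
    and fresh: "\<And>y. H v ((Some \<circ> a) |` X) y \<notin> elems T"
  obtains T' where "henkin_theory T'" "conservative T T'" "T' \<noteq> T"
proof -
  interpret orbital_theory V T using T by (simp add: henkin_theory_def)
  let ?a = "(Some \<circ> a) |` X"
  have domv: "finite (odom V v)" using A12 v by blast
  have da: "dom ?a = X" by auto
  then have fa: "finite (dom ?a)" using domv X by (metis finite_subset psubset_imp_subset)
  interpret orbital_witness V T v X a "H v ?a"
    by unfold_locales (use v X ex fresh H_inj[OF fa fa] in \<open>auto intro!: inj_onI\<close>)
  interpret ext: orbital_theory V ext by (rule ext_theory)
  have cons: "conservative T ext"
    using ext_extends ext_conservative by (auto simp: conservative_def)
  have wit: "(v, witness v ?a) \<in> ext"
    by (rule ext.T_cong[OF ext_witness]) (auto simp: val_def new_def witness_def)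
  have "witnessed w c ext" if c: "finite (dom c)" and k: "H w c y \<in> elems ext" for w c y
  proof (cases "H w c y \<in> elems T")
    case True
    then have "witnessed w c T" using T c unfolding henkin_theory_def by blast
    then show ?thesis by (rule witnessed_conservative[OF orbital_theory_axioms cons])
  next
    case False
    \<comment> \<open>By \<open>elems_ext\<close> a constant entering with the extension is one of
      the added witnesses, and injectivity of \<open>H\<close> shows that its task is the one just
      fulfilled.\<close>
    then have "H w c y \<in> H v ?a ` new" using k elems_ext by blast
    then have e: "w = v" "c = ?a" using H_inj[OF c fa] by blast+
    have "v \<sqsubseteq> u" if "c = Map.empty" "(u, H v c) \<in> ext" "odom V u \<subseteq> odom V v" for u
    proof (rule ext_generic)
      show "X = {}" using da that(1) e(2) by (metis dom_empty)
    qed (use that e in auto)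
    then show ?thesis using e wit by (simp add: witnessed_def)
  qed
  then have "henkin_theory ext" using ext_theory by (simp add: henkin_theory_def)
  moreover have "ext \<noteq> T"
  proof
    \<comment> \<open>Since \<open>X\<close> is a proper subset, some variable of \<open>v\<close>
      received a fresh constant, which \<open>T\<close> does not know.\<close>
    assume eq: "ext = T"
    obtain x where "x \<in> odom V v" "x \<notin> X" using X by blast
    then show False using T_elems[OF wit[unfolded eq], of x] fresh by (simp add: witness_def)
  qed
  ultimately show ?thesis using cons that by blast
qed

lemma henkin_maximal:
  obtains T where "henkin_theory T" "\<And>T'. henkin_theory T' \<Longrightarrow> conservative T T' \<Longrightarrow> T' = T"
proof -
  let ?A = "Collect henkin_theory"
  have "\<exists>T\<in>?A. \<forall>T'\<in>?A. conservative T T' \<longrightarrow> T' = T"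
  proof (rule predicate_Zorn)
    have "conservative T T" for T by (simp add: conservative_def)
    moreover have "T = T'" if "conservative T T'" "conservative T' T" for T T'
      using that by (auto simp: conservative_def)
    ultimately show "partial_order_on ?A (relation_of conservative ?A)"
      using conservative_trans by (intro partial_order_on_relation_ofI) blast+
    show "\<exists>U\<in>?A. \<forall>T\<in>C. conservative T U" if C: "C \<in> Chains (relation_of conservative ?A)" for C
    proof (cases "C = {}")
      case True
      then show ?thesis using henkin_trivial by blast
    next
      case False
      have 1: "henkin_theory T" if "T \<in> C" for T
        using C that by (auto simp: Chains_def relation_of_def)
      have 2: "conservative T T' \<or> conservative T' T" if "T \<in> C" "T' \<in> C" for T T'
        using C that unfolding Chains_def relation_of_def by blast
      show ?thesis using henkin_Union[OF False 1 2] by blast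
    qed
  qed
  then show ?thesis using that by blast
qed

text \<open>In a maximal theory no task has all its constants fresh, by
  \<open>henkin_extend\<close>. So one of them occurs, and the invariant says that the task is
  fulfilled.\<close>

lemma saturated_theory:
  obtains T :: "('a \<times> (var \<Rightarrow> 'k)) set" where "orbital_saturated V T"
proof -
  obtain T where T: "henkin_theory T" and max: "\<And>T'. henkin_theory T' \<Longrightarrow> conservative T T' \<Longrightarrow> T' = T"
    using henkin_maximal by metis
  interpret orbital_theory V T using T by (simp add: henkin_theory_def)
  have wit: "witnessed v ((Some \<circ> a) |` X) T"
    if v: "v \<in> carrier V" "v \<noteq> \<zero>" and X: "X \<subset> odom V v" and ex: "(v \<cdot> pid X, a) \<in> T" for v X a
  proof -
    obtain y where "H v ((Some \<circ> a) |` X) y \<in> elems T"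
      using henkin_extend[OF T ex v X] max by metis
    moreover have "finite (dom ((Some \<circ> a) |` X))"
      using A12[OF v] X by (auto intro: finite_subset)
    ultimately show ?thesis using T unfolding henkin_theory_def by blast
  qed
  show ?thesis
  proof (rule that[OF orbital_saturated.intro[OF orbital_theory_axioms orbital_saturated_axioms.intro]])
    fix v X a
    assume v: "v \<in> carrier V" "v \<noteq> \<zero>" and X: "X \<subseteq> odom V v" and ex: "(v \<cdot> pid X, a) \<in> T"
    show "\<exists>b. (v, b) \<in> T \<and> (\<forall>x\<in>X. b x = a x)"
    proof (cases "X = odom V v")
      case True
      then show ?thesis using ex act_pid_eq[OF v(1)] A12[OF v] by auto
    next
      case False
      then have "witnessed v ((Some \<circ> a) |` X) T" using wit v X ex by blast
      then show ?thesis
        by (intro exI[of _ "witness v ((Some \<circ> a) |` X)"]) (auto simp: witnessed_def witness_def)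
    qed
  next
    fix v assume v: "v \<in> carrier V" "v \<noteq> \<zero>"
    show "\<exists>b. (v, b) \<in> T \<and> (\<forall>u. (u, b) \<in> T \<longrightarrow> odom V u \<subseteq> odom V v \<longrightarrow> v \<sqsubseteq> u)"
    proof (cases "odom V v = {}")
      case True
      then have "v = \<one>" using odom_empty v by blast
      have "u = \<one>" if "(u, b) \<in> T" "odom V u \<subseteq> {}" for u b
        using odom_empty[OF T_carrier[OF that(1)] T_nonzero[OF that(1)]] that(2) by simp
      then show ?thesis using T_one[of undefined] \<open>v = \<one>\<close> le_refl[OF one_closed] by fastforce
    next
      case False
      then have "{} \<subset> odom V v" by blast
      \<comment> \<open>With \<open>X = {}\<close> no parameter is read, and \<open>A1\<close>
        reduces the hypothesis to \<open>T_one\<close>, so any valuation will do.\<close>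
      from wit[OF v this, of undefined] have "witnessed v Map.empty T" using A1[OF v] T_one by simp
      moreover have "witness v Map.empty = H v Map.empty" by (simp add: witness_def fun_eq_iff)
      ultimately show ?thesis by (auto simp: witnessed_def)
    qed
  qed
qed

end

section \<open>The representation\<close>

lemma tuplesD: "t \<in> tuples G X \<Longrightarrow> x \<in> X \<Longrightarrow> t x = Some (the (t x)) \<and> the (t x) \<in> G"
  by (auto simp: tuples_def ran_def)

section \<open>Equality in a theory\<close>

context orbital_theory
begin

definition same :: "'k \<Rightarrow> 'k \<Rightarrow> bool" where
  "same k l \<longleftrightarrow> (diag V 0 1, \<lambda>x. if x = 0 then k else l) \<in> T"

text \<open>The choice depends only on the predicate \<open>same k\<close>, so equal constants
  receive the same representative.\<close>

definition rep :: "'k \<Rightarrow> 'k" where "rep k = (SOME l. same k l)"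

lemma T_diag_transfer:
  assumes "(diag V p q, b) \<in> T" "p \<noteq> q" "x \<noteq> y" "b' x = b p" "b' y = b q"
  shows "(diag V x y, b') \<in> T"
proof -
  have "(diag V p q \<cdot> [x \<mapsto> p, y \<mapsto> q], b') \<in> T"
    using assms by (intro T_act[OF assms(1)]) (auto split: if_splits)
  moreover have "diag V p q \<cdot> [x \<mapsto> p, y \<mapsto> q] = diag V x y"
    using assms(3) by (intro diag_act) auto
  ultimately show ?thesis by simp
qed

lemma same_elems: "same k l \<Longrightarrow> k \<in> elems T \<and> l \<in> elems T"
  using T_elems[of "diag V 0 1" _ 0] T_elems[of "diag V 0 1" _ 1] by (force simp: same_def odom_diag)

lemma same_refl: "k \<in> elems T \<Longrightarrow> same k k"
  unfolding same_def by (rule T_diag_eq) auto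

lemma T_diag_iff: "(diag V x y, b) \<in> T \<longleftrightarrow> same (b x) (b y)"
proof (cases "x = y")
  case True
  then show ?thesis using T_diag_same same_refl same_elems by blast
next
  case False
  then show ?thesis
    unfolding same_def
    using T_diag_transfer[of x y b 0 1 "\<lambda>z. if z = 0 then b x else b y"]
      T_diag_transfer[of 0 1 "\<lambda>z. if z = 0 then b x else b y" x y b]
    by auto
qed

lemma same_sym: "same k l \<Longrightarrow> same l k"
  using T_diag_iff[of 1 0 "\<lambda>x. if x = 0 then k else l"] diag_sym[of 0 1] by (simp add: same_def)

lemma same_trans: "\<lbrakk>same k l; same l m\<rbrakk> \<Longrightarrow> same k m"
proof -
  assume a: "same k l" "same l m"
  let ?b = "\<lambda>x::var. if x = 0 then k else if x = 1 then l else m"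
  let ?u = "diag V 0 1 \<sqinter> diag V 1 2"
  have u: "(?u, ?b) \<in> T" using a by (intro T_meet) (simp_all add: T_diag_iff)
  have "?u \<sqsubseteq> diag V 0 2"
    using T_carrier[OF u] meet_le1 meet_le2 diag_closed by (intro le_diag_trans[of ?u 0 1 2]) auto
  then show ?thesis using T_up[OF u _ diag_closed] T_diag_iff[of 0 2 ?b] by simp
qed

lemma rep_same: "k \<in> elems T \<Longrightarrow> same k (rep k)"
  unfolding rep_def using same_refl by (rule someI)

lemma rep_eq: "same k l \<Longrightarrow> rep k = rep l"
proof -
  assume "same k l"
  then have "same k = same l" using same_sym same_trans by blast
  then show ?thesis by (simp add: rep_def)
qed

text \<open>Give each variable \<open>x\<close> of \<open>u\<close> a copy \<open>x + m\<close> with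
  value \<open>b' x\<close> and conjoin the diagonals between them. Then
  \<open>act_diag_cong\<close> reads \<open>u\<close> from the copies instead.\<close>

lemma T_same_cong:
  assumes T: "(u, b) \<in> T" and same: "\<And>x. x \<in> odom V u \<Longrightarrow> same (b x) (b' x)"
  shows "(u, b') \<in> T"
proof -
  let ?D = "odom V u"
  have fin: "finite ?D" by (rule T_finite[OF T])
  obtain m where m: "\<And>x. x \<in> ?D \<Longrightarrow> x < m"
    using finite_nat_set_iff_bounded[of ?D] fin by auto
  define c where "c x = (if x < m then b x else b' (x - m))" for x
  let ?f = "\<lambda>x. if x \<in> ?D then Some (x + m) else None"
  let ?E = "(\<lambda>x. (x, x + m)) ` ?D"
  have uc: "(u, c) \<in> T" by (rule T_cong[OF T]) (use m in \<open>auto simp: c_def\<close>)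
  have E: "(diag V p q, c) \<in> T" if "(p, q) \<in> ?E" for p q
    using that m same by (auto simp: T_diag_iff c_def)
  obtain w where w: "(w, c) \<in> T" "w \<sqsubseteq> u" "\<And>p q. (p, q) \<in> ?E \<Longrightarrow> w \<sqsubseteq> diag V p q"
  proof (rule T_meet_diags[OF finite_imageI[OF fin] uc E])
    fix w
    assume "(w, c) \<in> T" "w \<sqsubseteq> u" "\<And>p q. (p, q) \<in> ?E \<Longrightarrow> w \<sqsubseteq> diag V p q"
    then show thesis by (rule that)
  qed
  have cl: "u \<in> carrier V" "w \<in> carrier V" using T_carrier T w(1) by auto
  have f: "?f \<in> T_fp" using fin by (rule T_fp_total)
  have "w \<cdot> pid ?D = w \<cdot> ?f"
  proof (rule act_diag_cong)
    show "dom (pid ?D) = dom ?f" by (auto simp: pid_def split: if_splits)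
    show "w \<sqsubseteq> diag V p q" if "pid ?D x = Some p" "?f x = Some q" for x p q
      using that by (intro w(3)) (auto simp: pid_def split: if_splits)
  qed (use cl fin f in auto)
  moreover have "w \<cdot> pid ?D \<sqsubseteq> u"
    using A5[OF cl(2,1) T_fp_pid[OF fin] w(2)] act_pid_eq[OF cl(1) fin] by simp
  moreover have "(w \<cdot> ?f, b') \<in> T"
    by (rule T_act[OF w(1) f]) (auto simp: c_def split: if_splits)
  ultimately show ?thesis using T_up cl by simp
qed

section \<open>Tables of representatives\<close>

definition base :: "'k set" where "base = rep ` elems T"

definition table :: "'a \<Rightarrow> (var \<rightharpoonup> 'k) set" where
  "table u = {t \<in> tuples base (odom V u). (u, the \<circ> t) \<in> T}"

lemma base_elems: "g \<in> base \<Longrightarrow> g \<in> elems T"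
  using rep_same same_elems by (auto simp: base_def)

lemma base_same_iff: "\<lbrakk>g \<in> base; g' \<in> base\<rbrakk> \<Longrightarrow> same g g' \<longleftrightarrow> g = g'"
  using rep_same rep_eq same_refl base_elems by (auto simp: base_def) metis

lemma tableI:
  assumes "(u, b) \<in> T"
  shows "(\<lambda>x. if x \<in> odom V u then Some (rep (b x)) else None) \<in> table u"
  using T_same_cong[OF assms, of "the \<circ> (\<lambda>x. if x \<in> odom V u then Some (rep (b x)) else None)"]
    T_elems[OF assms] rep_same
  by (auto simp: table_def tuples_def base_def ran_def dom_def split: if_splits)

lemma table_zero: "table \<zero> = {}" using T_nonzero by (auto simp: table_def)

lemma table_Tab: "u \<in> carrier V \<Longrightarrow> table u \<in> Tab base"
proof (cases "u = \<zero>")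
  case False
  assume "u \<in> carrier V"
  then show ?thesis using A12 False by (intro TabI[of "odom V u"]) (auto simp: table_def)
qed (simp add: table_zero)

lemma table_one: "table \<one> = {Map.empty}"
  using T_one by (auto simp: table_def tuples_def)

lemma table_diag: "table (diag V x y) = tab_diag base x y"
proof -
  have "(diag V x y, the \<circ> t) \<in> T \<longleftrightarrow> t x = t y" if "t \<in> tuples base {x, y}" for t
  proof -
    have "t x = Some (the (t x)) \<and> the (t x) \<in> base" "t y = Some (the (t y)) \<and> the (t y) \<in> base"
      using tuplesD[OF that] by auto
    then show ?thesis using base_same_iff[of "the (t x)" "the (t y)"] by (metis T_diag_iff comp_apply)
  qed
  then show ?thesis by (auto simp: table_def tab_diag_def odom_diag)
qed

end

context orbital_saturated
begin

lemma table_nonempty: "\<lbrakk>u \<in> carrier V; u \<noteq> \<zero>\<rbrakk> \<Longrightarrow> table u \<noteq> {}"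
  using generic tableI by fastforce

lemma base_nonempty: "base \<noteq> {}"
proof -
  obtain t where "t \<in> table (diag V 0 0)" using table_nonempty diag_closed diag_nonzero by blast
  then have "t \<in> tuples base {0}" by (simp add: table_def odom_diag_same)
  then show ?thesis using tuplesD by fastforce
qed

lemma schema_table: "u \<in> carrier V \<Longrightarrow> schema (table u) = odom V u"
proof (cases "u = \<zero>")
  case True
  have "odom V \<zero> = UNIV" using zero_least diag_closed zero_closed by (simp add: A13)
  then show ?thesis using True table_zero by simp
next
  case False
  assume "u \<in> carrier V"
  then show ?thesis using table_nonempty False schema_eq[of "table u" base] by (auto simp: table_def)
qed

lemma table_meet:
  assumes u: "u \<in> carrier V" and v: "v \<in> carrier V"
  shows "table (u \<sqinter> v) = join base (table u) (table v)"
proof -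
  note c = meet_closed[OF u v]
  have iff: "(u \<sqinter> v, the \<circ> t) \<in> T \<longleftrightarrow> t |` odom V u \<in> table u \<and> t |` odom V v \<in> table v"
    if t: "t \<in> tuples base (odom V u \<union> odom V v)" for t
  proof -
    have "t |` odom V w \<in> table w \<longleftrightarrow> (w, the \<circ> t) \<in> T" if "odom V w \<subseteq> odom V u \<union> odom V v" for w
    proof -
      have "t |` odom V w \<in> tuples base (odom V w)" by (rule restr_tup[OF t that])
      then show ?thesis
        using T_cong[of w "the \<circ> t" "the \<circ> t |` odom V w"] T_cong[of w "the \<circ> t |` odom V w" "the \<circ> t"]
        by (auto simp: table_def)
    qed
    moreover have "(u \<sqinter> v, the \<circ> t) \<in> T \<longleftrightarrow> (u, the \<circ> t) \<in> T \<and> (v, the \<circ> t) \<in> T"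
      using T_meet T_up meet_le1[OF u v] meet_le2[OF u v] u v by blast
    ultimately show ?thesis by auto
  qed
  show ?thesis
  proof (cases "u \<sqinter> v = \<zero>")
    \<comment> \<open>The domain of \<open>\<zero>\<close> is \<open>UNIV\<close>, so
      \<open>odom_meet\<close> does not apply. The join is empty by \<open>iff\<close>, as no
      formula in \<open>T\<close> is zero.\<close>
    case True
    then show ?thesis
      using iff T_nonzero[of "u \<sqinter> v"] schema_table[OF u] schema_table[OF v] table_zero
      by (auto simp: join_def)
  next
    case False
    then show ?thesis
      using iff odom_meet[OF u v] schema_table[OF u] schema_table[OF v]
      by (auto simp: join_def table_def[of "u \<sqinter> v"])
  qed
qed

lemma table_act:
  assumes u: "u \<in> carrier V" and f: "f \<in> T_fp"
  shows "table (u \<cdot> f) = tab_act (table u) f"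
proof (cases "u = \<zero>")
  case True
  then show ?thesis using A2[OF f] table_zero by simp
next
  case False
  have fin: "finite (odom V u)" using A12[OF u False] .
  have od: "odom V (u \<cdot> f) = pmap_vimage f (odom V u)" by (rule A11[OF u f False])
  note uf = act_closed[OF u f]
  show ?thesis
  proof (intro equalityI subsetI)
    fix s assume "s \<in> tab_act (table u) f"
    then obtain t where t: "t \<in> tuples base (odom V u)" "(u, the \<circ> t) \<in> T" "s = t \<circ>\<^sub>m f"
      by (auto simp: tab_act_def table_def)
    have "(u \<cdot> f, the \<circ> s) \<in> T" by (rule T_act[OF t(2) f]) (simp add: t(3) map_comp_def)
    then show "s \<in> table (u \<cdot> f)" using comp_tup[OF t(1), of f] t(3) od by (simp add: table_def)
  next
    fix s assume "s \<in> table (u \<cdot> f)"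
    then have s: "s \<in> tuples base (odom V (u \<cdot> f))" and sT: "(u \<cdot> f, the \<circ> s) \<in> T"
      by (auto simp: table_def)
    \<comment> \<open>\<open>f\<close> may merge variables and may miss some of \<open>u\<close>.
      \<open>X\<close> collects those it reaches and \<open>sec\<close> picks a preimage of each, so
      \<open>s\<close> read through \<open>sec\<close> satisfies \<open>u \<cdot> pid X\<close>;
      \<open>saturated\<close> supplies the missed values.\<close>
    define X where "X = {y \<in> odom V u. \<exists>x. f x = Some y}"
    define sec where "sec y = (SOME x. f x = Some y)" for y
    let ?g = "\<lambda>y. if y \<in> X then Some (sec y) else None"
    have sec: "f (sec y) = Some y" if "y \<in> X" for y
      using that someI_ex[of "\<lambda>x. f x = Some y"] by (auto simp: X_def sec_def)
    have finX: "finite X" using fin by (simp add: X_def)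
    then have g: "?g \<in> T_fp" by (rule T_fp_total)
    have "f \<circ>\<^sub>m ?g = pid X" using sec by (auto simp: map_comp_def pid_def)
    moreover have "(u \<cdot> f \<cdot> ?g, \<lambda>y. the (s (sec y))) \<in> T"
      by (rule T_act[OF sT g]) (auto split: if_splits)
    ultimately have "(u \<cdot> pid X, \<lambda>y. the (s (sec y))) \<in> T" using A7[OF u f g] by simp
    then obtain b where b: "(u, b) \<in> T" "\<And>y. y \<in> X \<Longrightarrow> b y = the (s (sec y))"
      using saturated[OF u False, of X "\<lambda>y. the (s (sec y))"] unfolding X_def by blast
    let ?t = "\<lambda>x. if x \<in> odom V u then Some (rep (b x)) else None"
    have "?t \<circ>\<^sub>m f = s"
    proof
      fix x show "(?t \<circ>\<^sub>m f) x = s x"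
      proof (cases "x \<in> odom V (u \<cdot> f)")
        case False
        then have "s x = None" using s by (auto simp: tuples_def)
        moreover have "(?t \<circ>\<^sub>m f) x = None"
          using False od by (auto simp: pmap_vimage_def map_comp_def split: option.splits)
        ultimately show ?thesis by simp
      next
        case True
        then obtain y where y: "f x = Some y" "y \<in> odom V u" by (auto simp: od pmap_vimage_def)
        then have yX: "y \<in> X" by (auto simp: X_def)
        then have sx: "sec y \<in> odom V (u \<cdot> f)" using sec[OF yX] y od by (auto simp: pmap_vimage_def)
        \<comment> \<open>Every other preimage \<open>x\<close> of \<open>y\<close> has the same
          value in \<open>s\<close>, because \<open>u \<cdot> f\<close> lies below the diagonal of
          \<open>sec y\<close> and \<open>x\<close>.\<close>
        have "u \<sqsubseteq> diag V y y" using y(2) u A13 by simp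
        then have "u \<cdot> f \<sqsubseteq> diag V (sec y) x" by (rule le_diag_act[OF u _ f sec[OF yX] y(1)])
        then have "same (the (s (sec y))) (the (s x))"
          using T_up[OF sT _ diag_closed] T_diag_iff[of "sec y" x "the \<circ> s"] by simp
        then have eq: "the (s (sec y)) = the (s x)"
          using base_same_iff tuplesD[OF s sx] tuplesD[OF s True] by simp
        have "rep (the (s x)) = the (s x)"
        proof -
          have gx: "the (s x) \<in> base" using tuplesD[OF s True] by simp
          then have "same (the (s x)) (rep (the (s x)))" using rep_same base_elems by blast
          moreover have "rep (the (s x)) \<in> base" using gx base_elems by (auto simp: base_def)
          ultimately show ?thesis using base_same_iff[OF gx] by simp
        qed
        then show ?thesis using b(2)[OF yX] eq y tuplesD[OF s True] by (simp add: map_comp_def)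
      qed
    qed
    then show "s \<in> tab_act (table u) f" using tableI[OF b(1)] by (auto simp: tab_act_def)
  qed
qed

text \<open>The tuple of a generic valuation of \<open>v\<close> lies in the table of
  \<open>u\<close> too, so \<open>u\<close> holds of it and is a consequence of
  \<open>v\<close>.\<close>

lemma table_le:
  assumes v: "v \<in> carrier V" "v \<noteq> \<zero>" and eq: "table u = table v" "odom V u = odom V v"
  shows "v \<sqsubseteq> u"
proof -
  obtain b where b: "(v, b) \<in> T" "\<And>u. (u, b) \<in> T \<Longrightarrow> odom V u \<subseteq> odom V v \<Longrightarrow> v \<sqsubseteq> u"
    using generic[OF v] by blast
  let ?t = "\<lambda>x. if x \<in> odom V v then Some (rep (b x)) else None"
  have "(u, the \<circ> ?t) \<in> T" using tableI[OF b(1)] unfolding eq(1)[symmetric] by (simp add: table_def)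
  then have "(u, b) \<in> T"
    by (rule T_same_cong) (use T_elems[OF b(1)] rep_same same_sym eq(2) in auto)
  then show ?thesis using b(2) eq(2) by simp
qed

lemma table_inj: "inj_on table (carrier V)"
proof (rule inj_onI)
  fix u v assume c: "u \<in> carrier V" "v \<in> carrier V" and eq: "table u = table v"
  have od: "odom V u = odom V v" using schema_table c eq by metis
  have "u = \<zero> \<longleftrightarrow> v = \<zero>" using table_nonempty table_zero c eq by metis
  then show "u = v"
    using table_le[OF c(2) _ eq od] table_le[OF c(1) _ eq[symmetric] od[symmetric]] le_antisym c by blast
qed

lemma table_embedding: "table \<in> orbital_embedding V (table_algebra base)"
  unfolding orbital_embedding_def orbital_hom_def
  using table_inj table_Tab table_meet table_zero table_one table_diag table_act schema_table
  by (auto simp: table_algebra_def)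

end

section \<open>Coding of witnesses by lists\<close>

fun encode :: "(nat \<times> ('a + nat) list) list \<Rightarrow> ('a + nat) list" where
  "encode [] = []"
| "encode ((x, k) # xs) = Inr x # Inr (length k) # k @ encode xs"

text \<open>The length written before each value makes the code self-delimiting.\<close>

lemma encode_inj: "encode xs = encode ys \<Longrightarrow> xs = ys"
proof (induction xs arbitrary: ys)
  case Nil
  then show ?case by (cases ys) auto
next
  case (Cons p xs)
  then show ?case by (cases p; cases ys) auto
qed

definition graph_list :: "(nat \<rightharpoonup> 'b) \<Rightarrow> (nat \<times> 'b) list" where
  "graph_list a = map (\<lambda>x. (x, the (a x))) (sorted_list_of_set (dom a))"

lemma map_of_graph_list: "finite (dom a) \<Longrightarrow> map_of (graph_list a) = a"
  by (auto simp: graph_list_def map_of_map_restrict restrict_map_def fun_eq_iff domIff)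

text \<open>The parameters in \<open>a\<close> may be codes of other witnesses, so codes must nest
  within one type; \<open>encode\<close> flattens them to a list over
  \<open>'a + nat\<close>.\<close>

definition witness_code :: "'a \<Rightarrow> (var \<rightharpoonup> ('a + nat) list) \<Rightarrow> var \<Rightarrow> ('a + nat) list" where
  "witness_code v a y = Inl v # Inr y # encode (graph_list a)"

theorem theorem4:
  fixes V :: "('a, 'm) orbital_alg_scheme"
  assumes "orbital_semilattice V"
  shows "\<exists>(G :: ('a + nat) list set) \<phi>. G \<noteq> {} \<and> \<phi> \<in> orbital_embedding V (table_algebra G)"
proof -
  interpret orbital_semilattice V by fact
  interpret orbital_henkin V witness_code
    by unfold_locales (metis encode_inj list.inject map_of_graph_list sum.inject witness_code_def)
  obtain T :: "('a \<times> (var \<Rightarrow> ('a + nat) list)) set" where "orbital_saturated V T"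
    using saturated_theory by blast
  then interpret orbital_saturated V T .
  show ?thesis using base_nonempty table_embedding by blast
qed

end
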